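(* Let $\alpha,\beta\in[0,\pi)$ and let $\omega\in L^1([0,1],\mathbb{R})$ with $\omega>0$ a.e. on $[0,1]$. Assume moreover that (H1) $\omega$ is monotonic on $[0,1]$, and (H2) $\inf_{x\in[0,1]}\omega(x)>0$. For $q\in L^1([0,1],\mathbb{R})$ let $\lambda_1(q)<\lambda_2(q)<\cdots$ denote the eigenvalues of the regular Sturm–Liouville problem $$-y''(x)+q(x)y(x)=\lambda\,\omega(x)\,y(x)\quad\text{on }[0,1],$$ $$y(0)\cos\alpha+y'(0)\sin\alpha=0,\qquad y(1)\cos\beta+y'(1)\sin\beta=0.$$ Then for every subset $\Omega\subset L^1([0,1],\mathbb{R})$ that is bounded in the $L^1$-norm there exists a constant $C(\Omega)>0$ such that $$|\lambda_n(q_1)-\lambda_n(q_2)|\le C(\Omega)\,\|q_1-q_2\|_{L^1}$$ for all integers $n\ge 1$ and all $q_1,q_2\in\Omega$.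
   Context: Under the stated assumptions the problem has countably many real, simple eigenvalues $-\infty<\lambda_1(q)<\lambda_2(q)<\cdots$ with $\lambda_n(q)\to\infty$; $\lambda_n(q)$ denotes the $n$-th one. $\|\cdot\|_{L^1}$ is the usual norm of $L^1[0,1]$. The constant $C(\Omega)$ is required to be independent of $n$. *)

theory Defs
  imports "HOL-Analysis.Analysis"
begin

text \<open>Carath\'eodory solutions of  -y'' + q y = lam w y  on [0,1]:
  y is C^1 with derivative y', and y' is absolutely continuous with
  y'' = (q - lam w) y a.e., i.e. y'(x) = y'(0) + integral over [0,x].\<close>
definition sl_solution ::
  "(real \<Rightarrow> real) \<Rightarrow> (real \<Rightarrow> real) \<Rightarrow> real \<Rightarrow> (real \<Rightarrow> real) \<Rightarrow> (real \<Rightarrow> real) \<Rightarrow> bool" where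
  "sl_solution q w lam y y' \<longleftrightarrow>
     (\<forall>x\<in>{0..1}. (y has_real_derivative y' x) (at x within {0..1})) \<and>
     (\<lambda>t. (q t - lam * w t) * y t) absolutely_integrable_on {0..1} \<and>
     (\<forall>x\<in>{0..1}. y' x = y' 0 + integral {0..x} (\<lambda>t. (q t - lam * w t) * y t))"

definition sl_eigenvalue ::
  "real \<Rightarrow> real \<Rightarrow> (real \<Rightarrow> real) \<Rightarrow> (real \<Rightarrow> real) \<Rightarrow> real \<Rightarrow> bool" where
  "sl_eigenvalue \<alpha> \<beta> w q lam \<longleftrightarrow>
     (\<exists>y y'. sl_solution q w lam y y' \<and> (\<exists>x\<in>{0..1}. y x \<noteq> 0) \<and>
        y 0 * cos \<alpha> + y' 0 * sin \<alpha> = 0 \<and>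
        y 1 * cos \<beta> + y' 1 * sin \<beta> = 0)"

definition sl_eig :: "real \<Rightarrow> real \<Rightarrow> (real \<Rightarrow> real) \<Rightarrow> (real \<Rightarrow> real) \<Rightarrow> nat \<Rightarrow> real" where
  "sl_eig \<alpha> \<beta> w q n =
     (THE lam. sl_eigenvalue \<alpha> \<beta> w q lam \<and>
        finite {mu. sl_eigenvalue \<alpha> \<beta> w q mu \<and> mu < lam} \<and>
        card {mu. sl_eigenvalue \<alpha> \<beta> w q mu \<and> mu < lam} = n - 1)"

end

theory Submission
  imports Defs
begin

text \<open>Write a solution as \<open>y = \<rho> sin \<theta>\<close>, \<open>y' = \<rho> cos \<theta>\<close>. The Pruefer angle \<open>\<theta>\<close> at \<open>1\<close> is increasing in
  \<open>lam\<close>, and the \<open>n\<close>-th eigenvalue is where it equals \<open>n pi - \<beta>\<close>. Moving along the segment from \<open>q1\<close> to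
  \<open>q2\<close> while raising \<open>lam\<close> by \<open>C \<parallel>q1 - q2\<parallel>\<close> in total does not decrease the angle at \<open>1\<close>, provided
  \<open>y\<^sup>2 \<le> C \<integral> w y\<^sup>2\<close> for all solutions along the way. For bounded \<open>lam\<close> this bound is elementary. For
  large \<open>lam\<close> it comes from the monotonicity of \<open>w\<close>: up to the contribution of \<open>q\<close>, one of the energies
  \<open>y'\<^sup>2 + lam w y\<^sup>2\<close> and \<open>y'\<^sup>2 / w + lam y\<^sup>2\<close> increases and the other one decreases, so the energy is comparable
  at any two points. Below some \<open>lam\<close> that depends only on the bound for \<open>\<parallel>q\<parallel>\<close> there are no eigenvalues, by
  comparison with an explicit supersolution.\<close>

section \<open>Indefinite integrals\<close>

text \<open>The condition \<open>y\<^sup>2 \<le> C \<integral> w y\<^sup>2\<close> reflects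
  first-order perturbation: a change \<open>h\<close> of the potential moves an eigenvalue by the
  quotient of \<open>\<integral> h y\<^sup>2\<close> and \<open>\<integral> w y\<^sup>2\<close>, and
  \<open>C\<close> bounds this quotient by the L1 norm of \<open>h\<close>. Two obstacles shape the
  proof. The coefficients are merely integrable, so angles are only absolutely continuous; all
  calculus runs through the integral identity \<open>ac\<close>, and differences of angles satisfy
  an exact linear equation with an integrating factor, so no derivative in a parameter is ever
  taken. Moreover a monotone weight may jump, so the energies are not absolutely continuous; their
  increments are estimated on short intervals, with an error of variation times length. The chain
  rule, the energies and the path of potentials all pass to the limit by one and the same refinement
  argument.\<close>

abbreviation L1 :: "(real \<Rightarrow> real) \<Rightarrow> bool" where
  "L1 g \<equiv> g absolutely_integrable_on {0..1}"

text \<open>\<open>f\<close> is absolutely continuous on \<open>[0,1]\<close> with derivative \<open>g\<close> almost everywhere.\<close>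
definition ac :: "(real \<Rightarrow> real) \<Rightarrow> (real \<Rightarrow> real) \<Rightarrow> bool" where
  "ac f g \<longleftrightarrow> L1 g \<and> (\<forall>x\<in>{0..1}. f x = f 0 + integral {0..x} g)"

lemma L1_mult_continuous:
  assumes "L1 g" "continuous_on {0..1} h"
  shows "L1 (\<lambda>t. h t * g t)" "L1 (\<lambda>t. g t * h t)"
proof -
  have "bounded (h ` {0..1})"
    using assms(2) compact_continuous_image compact_imp_bounded compact_Icc by blast
  moreover have "h \<in> borel_measurable (lebesgue_on {0..1})"
    by (rule continuous_imp_measurable_on_sets_lebesgue[OF assms(2)]) simp
  ultimately show "L1 (\<lambda>t. h t * g t)"
    using absolutely_integrable_bounded_measurable_product_real[of h "{0..1}" g] assms(1) by auto
  then show "L1 (\<lambda>t. g t * h t)" by (simp add: mult.commute)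
qed

lemma L1_continuous: "continuous_on {0..1} h \<Longrightarrow> L1 h"
  by (rule absolutely_integrable_continuous_real)

lemma L1_abs: "L1 g \<Longrightarrow> L1 (\<lambda>t. \<bar>g t\<bar>)"
  by (rule set_integrable_abs)

lemma L1_sub: "L1 g \<Longrightarrow> 0 \<le> a \<Longrightarrow> b \<le> 1 \<Longrightarrow> g absolutely_integrable_on {a..b}"
  by (rule absolutely_integrable_on_subinterval) auto

lemma L1_int: "L1 g \<Longrightarrow> 0 \<le> a \<Longrightarrow> b \<le> 1 \<Longrightarrow> g integrable_on {a..b}"
  by (rule set_lebesgue_integral_eq_integral(1)[OF L1_sub])

lemmas L1_add = set_integral_add(1)[where A = "{0..1::real}" and M = lebesgue]
lemmas L1_diff = set_integral_diff(1)[where A = "{0..1::real}" and M = lebesgue]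
lemma L1_cmult: "L1 g \<Longrightarrow> L1 (\<lambda>t. c * g t)"
  by (intro L1_mult_continuous continuous_intros)

lemma L1_integral_abs_mono:
  assumes "L1 g" "0 \<le> a" "a \<le> b" "b \<le> 1"
  shows "\<bar>integral {a..b} g\<bar> \<le> integral {a..b} (\<lambda>t. \<bar>g t\<bar>)"
  using integral_norm_bound_integral[OF L1_int[OF assms(1)] L1_int[OF L1_abs[OF assms(1)]], of a b] assms
  by simp

lemma L1_integral_abs_le:
  assumes "L1 g" "0 \<le> a" "a \<le> b" "b \<le> 1"
  shows "integral {a..b} (\<lambda>t. \<bar>g t\<bar>) \<le> integral {0..1} (\<lambda>t. \<bar>g t\<bar>)"
  using assms by (intro integral_subset_le L1_int L1_abs) auto

text \<open>A refinement argument: errors that are small relative to an additive majorant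
  disappear in the limit of fine partitions.\<close>
lemma nondecreasing_if_locally_up_to_eps:
  fixes \<Phi> \<mu> :: "real \<Rightarrow> real"
  assumes loc: "\<And>\<epsilon>. \<epsilon> > 0 \<Longrightarrow> \<exists>\<delta>>0. \<forall>a b. 0 \<le> a \<and> a \<le> b \<and> b \<le> 1 \<and> b - a < \<delta> \<longrightarrow>
                  \<Phi> a \<le> \<Phi> b + \<epsilon> * (\<mu> b - \<mu> a)"
    and xy: "0 \<le> x" "x \<le> y" "y \<le> 1"
  shows "\<Phi> x \<le> \<Phi> y"
proof -
  have main: "\<Phi> x \<le> \<Phi> y + \<epsilon> * (\<mu> y - \<mu> x)" if "\<epsilon> > 0" for \<epsilon>
  proof -
    obtain \<delta> where \<delta>: "\<delta> > 0" and
      d: "\<And>a b. 0 \<le> a \<Longrightarrow> a \<le> b \<Longrightarrow> b \<le> 1 \<Longrightarrow> b - a < \<delta> \<Longrightarrow> \<Phi> a \<le> \<Phi> b + \<epsilon> * (\<mu> b - \<mu> a)"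
      using loc[OF \<open>\<epsilon> > 0\<close>] by blast
    obtain N :: nat where N: "(y - x) / \<delta> < real N"
      using reals_Archimedean2 by blast
    have N0: "N > 0"
      using N \<delta> xy by (cases N) (auto simp: divide_less_0_iff not_less)
    define h where "h = (y - x) / N"
    have h: "0 \<le> h" "h < \<delta>" "N * h = y - x"
      using N N0 \<delta> xy by (auto simp: h_def field_simps)
    \<comment> \<open>Telescoping over steps of length \<open>h\<close>: the errors add up to one
      increment of \<open>\<mu>\<close>, whatever \<open>N\<close> is.\<close>
    have "\<Phi> x \<le> \<Phi> (x + i * h) + \<epsilon> * (\<mu> (x + i * h) - \<mu> x)" if "i \<le> N" for i :: nat
      using that
    proof (induction i)
      case (Suc i)
      have "real (Suc i) * h \<le> N * h" using Suc.prems h(1) by (intro mult_right_mono) auto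
      then have "\<Phi> (x + i * h) \<le> \<Phi> (x + Suc i * h) + \<epsilon> * (\<mu> (x + Suc i * h) - \<mu> (x + i * h))"
        using h xy by (intro d) (auto simp: algebra_simps)
      then show ?case using Suc by (simp add: algebra_simps)
    qed simp
    from this[of N] show ?thesis using h(3) by simp
  qed
  show ?thesis
  proof (rule ccontr)
    assume c: "\<not> \<Phi> x \<le> \<Phi> y"
    define \<epsilon> where "\<epsilon> = (\<Phi> x - \<Phi> y) / (2 * (\<bar>\<mu> y - \<mu> x\<bar> + 1))"
    have e: "\<epsilon> > 0" unfolding \<epsilon>_def using c by (intro divide_pos_pos) (auto simp: add_nonneg_pos)
    have "\<epsilon> * (\<mu> y - \<mu> x) \<le> \<epsilon> * (\<bar>\<mu> y - \<mu> x\<bar> + 1)" using e by (intro mult_left_mono) auto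
    also have "\<dots> = (\<Phi> x - \<Phi> y) / 2"
    proof -
      have "\<bar>\<mu> y - \<mu> x\<bar> + 1 \<noteq> 0" by linarith
      then show ?thesis unfolding \<epsilon>_def times_divide_eq_left by (subst mult_divide_mult_cancel_right) auto
    qed
    finally show False using main[OF e] c by simp
  qed
qed

section \<open>Calculus of absolutely continuous functions\<close>

lemma ac_L1: "ac f g \<Longrightarrow> L1 g"
  by (simp add: ac_def)

lemma ac_eq: "ac f g \<Longrightarrow> x \<in> {0..1} \<Longrightarrow> f x = f 0 + integral {0..x} g"
  unfolding ac_def by blast

lemma acI: "L1 g \<Longrightarrow> (\<And>x. x \<in> {0..1} \<Longrightarrow> f x = f 0 + integral {0..x} g) \<Longrightarrow> ac f g"
  unfolding ac_def by blast

lemma ac_diff_integral: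
  assumes "ac f g" "0 \<le> a" "a \<le> b" "b \<le> 1"
  shows "f b - f a = integral {a..b} g"
proof -
  have "integral {0..a} g + integral {a..b} g = integral {0..b} g"
    using assms ac_L1[OF assms(1)] by (intro Henstock_Kurzweil_Integration.integral_combine L1_int) auto
  then show ?thesis using assms ac_eq[OF assms(1), of a] ac_eq[OF assms(1), of b] by simp
qed

lemma ac_abs_diff_le:
  assumes "ac f g" "0 \<le> a" "a \<le> b" "b \<le> 1"
  shows "\<bar>f b - f a\<bar> \<le> integral {a..b} (\<lambda>t. \<bar>g t\<bar>)"
  using ac_diff_integral[OF assms] L1_integral_abs_mono[OF ac_L1[OF assms(1)] assms(2-4)] by simp

lemma ac_continuous:
  assumes "ac f g"
  shows "continuous_on {0..1} f"
proof -
  have "continuous_on {0..1} (\<lambda>x. f 0 + integral {0..x} g)"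
    using ac_L1[OF assms] by (intro continuous_intros indefinite_integral_continuous_1 L1_int) auto
  then show ?thesis
    by (rule continuous_on_eq) (rule ac_eq[OF assms, symmetric])
qed

lemma ac_integral: "L1 g \<Longrightarrow> ac (\<lambda>x. c + integral {0..x} g) g"
  by (simp add: ac_def)

lemma ac_cong:
  assumes "ac f g" "\<And>x. x \<in> {0..1} \<Longrightarrow> f x = f' x" "\<And>x. x \<in> {0..1} \<Longrightarrow> g x = g' x"
  shows "ac f' g'"
proof (rule acI)
  show "L1 g'"
    using ac_L1[OF assms(1)] by (rule absolutely_integrable_spike[of _ _ "{}"]) (use assms(3) in auto)
  fix x :: real assume x: "x \<in> {0..1}"
  have "integral {0..x} g = integral {0..x} g'"
    using x by (intro integral_cong assms(3)) auto
  then show "f' x = f' 0 + integral {0..x} g'"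
    using ac_eq[OF assms(1) x] assms(2)[of x] assms(2)[of 0] x by simp
qed

lemma ac_const: "ac (\<lambda>x. c) (\<lambda>x. 0)"
  by (simp add: ac_def)

lemma ac_add:
  assumes "ac f g" "ac u v"
  shows "ac (\<lambda>x. f x + u x) (\<lambda>x. g x + v x)"
proof (rule acI)
  show "L1 (\<lambda>x. g x + v x)" by (rule L1_add[OF ac_L1[OF assms(1)] ac_L1[OF assms(2)]])
  fix x :: real assume x: "x \<in> {0..1}"
  have "integral {0..x} (\<lambda>t. g t + v t) = integral {0..x} g + integral {0..x} v"
    using x ac_L1[OF assms(1)] ac_L1[OF assms(2)] by (intro integral_add L1_int) auto
  then show "f x + u x = f 0 + u 0 + integral {0..x} (\<lambda>t. g t + v t)"
    using ac_eq[OF assms(1) x] ac_eq[OF assms(2) x] by simp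
qed

lemma ac_cmult:
  assumes "ac f g"
  shows "ac (\<lambda>x. c * f x) (\<lambda>x. c * g x)"
proof (rule acI)
  show "L1 (\<lambda>x. c * g x)" by (rule L1_cmult[OF ac_L1[OF assms]])
  fix x :: real assume x: "x \<in> {0..1}"
  show "c * f x = c * f 0 + integral {0..x} (\<lambda>t. c * g t)"
    using ac_eq[OF assms x] by (simp add: distrib_left)
qed

lemma ac_diff: "ac f g \<Longrightarrow> ac u v \<Longrightarrow> ac (\<lambda>x. f x - u x) (\<lambda>x. g x - v x)"
  using ac_add[of f g "\<lambda>x. - 1 * u x" "\<lambda>x. -1 * v x"] ac_cmult[of u v "-1"] by simp

lemma ac_from_deriv:
  assumes "\<And>x. x \<in> {0..1} \<Longrightarrow> (f has_real_derivative g x) (at x within {0..1})"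
    and "continuous_on {0..1} g"
  shows "ac f g"
proof (rule acI[OF L1_continuous[OF assms(2)]])
  fix x :: real assume x: "x \<in> {0..1}"
  have "(g has_integral (f x - f 0)) {0..x}"
  proof (rule fundamental_theorem_of_calculus)
    fix t assume t: "t \<in> {0..x}"
    then have "(f has_vector_derivative g t) (at t within {0..1})"
      using assms(1)[of t] x by (simp add: has_real_derivative_iff_has_vector_derivative)
    then show "(f has_vector_derivative g t) (at t within {0..x})"
      by (rule has_vector_derivative_within_subset) (use x in auto)
  qed (use x in auto)
  then have "integral {0..x} g = f x - f 0" by (rule integral_unique)
  then show "f x = f 0 + integral {0..x} g" by linarith
qed

lemma ac_has_deriv:
  assumes "ac f g" "continuous_on {0..1} g" "x \<in> {0..1}"
  shows "(f has_real_derivative g x) (at x within {0..1})"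
proof -
  have "((\<lambda>x. f 0 + integral {0..x} g) has_real_derivative g x) (at x within {0..1})"
    using integral_has_real_derivative[OF assms(2,3)] by (auto intro!: derivative_eq_intros)
  then show ?thesis
    by (rule has_field_derivative_transform_within[where d = 1, OF _ _ assms(3) ac_eq[OF assms(1), symmetric]])
       simp
qed

lemma ac_mono:
  assumes "ac f g" "\<And>x. x \<in> {0..1} \<Longrightarrow> 0 \<le> g x" "0 \<le> x" "x \<le> y" "y \<le> 1"
  shows "f x \<le> f y"
proof -
  have "0 \<le> integral {x..y} g"
    using assms ac_L1[OF assms(1)] by (intro integral_nonneg L1_int) auto
  then show ?thesis using ac_diff_integral[OF assms(1,3-5)] by simp
qed

lemma ac_zero_const:
  assumes "ac f g" "\<And>x. x \<in> {0..1} \<Longrightarrow> g x = 0" "x \<in> {0..1}"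
  shows "f x = f 0"
proof -
  have "integral {0..x} g = integral {0..x} (\<lambda>x. 0)" using assms by (intro integral_cong) auto
  then show ?thesis using ac_eq[OF assms(1,3)] by simp
qed

text \<open>On a short interval the mean value theorem replaces \<open>\<Psi>'\<close> by a constant
  \<open>\<Psi>' \<xi>\<close>, and uniform continuity keeps the error below
  \<open>\<epsilon>\<close> times the increment of the primitive \<open>\<mu>\<close> of
  \<open>\<bar>g\<bar>\<close>. The refinement argument, used for both signs, removes the error
  without any pointwise derivative of \<open>f\<close>.\<close>

lemma ac_chain:
  assumes fg: "ac f g"
    and der: "\<And>u. (\<Psi> has_real_derivative \<Psi>' u) (at u)"
    and cont: "continuous_on UNIV \<Psi>'"
  shows "ac (\<lambda>x. \<Psi> (f x)) (\<lambda>x. \<Psi>' (f x) * g x)"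
proof -
  define k where "k = (\<lambda>x. \<Psi>' (f x) * g x)"
  define \<mu> where "\<mu> = (\<lambda>x. integral {0..x} (\<lambda>t. \<bar>g t\<bar>))"
  have fc: "continuous_on {0..1} f" using ac_continuous[OF fg] .
  have Lg: "L1 g" using fg ac_L1 by blast
  have Lk: "L1 k" unfolding k_def
    by (intro L1_mult_continuous Lg continuous_on_compose2[OF cont fc]) auto
  obtain B where B: "\<And>x. x \<in> {0..1} \<Longrightarrow> \<bar>f x\<bar> \<le> B"
    using compact_imp_bounded[OF compact_continuous_image[OF fc compact_Icc]]
    unfolding bounded_iff by fastforce
  have uc: "uniformly_continuous_on {-B..B} \<Psi>'"
    using cont continuous_on_subset by (intro compact_uniformly_continuous) auto
  have ufc: "uniformly_continuous_on {0..1} f"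
    using fc by (intro compact_uniformly_continuous) auto
  have loc: "\<exists>\<delta>>0. \<forall>a b. 0 \<le> a \<and> a \<le> b \<and> b \<le> 1 \<and> b - a < \<delta> \<longrightarrow>
      \<bar>\<Psi> (f b) - \<Psi> (f a) - integral {a..b} k\<bar> \<le> \<epsilon> * (\<mu> b - \<mu> a)" if e: "\<epsilon> > 0" for \<epsilon>
  proof -
    obtain r where r: "r > 0" "\<And>v u. v \<in> {-B..B} \<Longrightarrow> u \<in> {-B..B} \<Longrightarrow> dist u v < r \<Longrightarrow> dist (\<Psi>' u) (\<Psi>' v) < \<epsilon>"
      by (rule uniformly_continuous_onE[OF uc e]) (rule that)
    have "r / 2 > 0" using r(1) by simp
    then obtain \<delta> where \<delta>: "\<delta> > 0"
        "\<And>v u. v \<in> {0..1} \<Longrightarrow> u \<in> {0..1} \<Longrightarrow> dist u v < \<delta> \<Longrightarrow> dist (f u) (f v) < r / 2"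
      by (rule uniformly_continuous_onE[OF ufc]) (rule that)
    have "\<bar>\<Psi> (f b) - \<Psi> (f a) - integral {a..b} k\<bar> \<le> \<epsilon> * (\<mu> b - \<mu> a)"
      if ab: "0 \<le> a" "a \<le> b" "b \<le> 1" "b - a < \<delta>" for a b
    proof -
      have fab: "\<bar>f b - f a\<bar> < r / 2" using \<delta>(2)[of a b] ab by (simp add: dist_real_def)
      \<comment> \<open>In all three cases \<open>\<xi>\<close> lies between \<open>f a\<close> and
        \<open>f b\<close>, hence in the compact range where \<open>\<Psi>'\<close> is uniformly
        continuous.\<close>
      have "\<exists>\<xi>. \<bar>\<xi> - f a\<bar> \<le> \<bar>f b - f a\<bar> \<and> \<xi> \<in> {-B..B} \<and> \<Psi> (f b) - \<Psi> (f a) = (f b - f a) * \<Psi>' \<xi>"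
      proof -
        consider "f a < f b" | "f b < f a" | "f a = f b" by linarith
        then show ?thesis
        proof cases
          case 1
          obtain z where "f a < z" "z < f b" "\<Psi> (f b) - \<Psi> (f a) = (f b - f a) * \<Psi>' z"
            using MVT2[OF 1, of \<Psi> \<Psi>'] der by auto
          then show ?thesis using B[of a] B[of b] ab by (intro exI[of _ z]) auto
        next
          case 2
          obtain z where "f b < z" "z < f a" "\<Psi> (f a) - \<Psi> (f b) = (f a - f b) * \<Psi>' z"
            using MVT2[OF 2, of \<Psi> \<Psi>'] der by auto
          then show ?thesis using B[of a] B[of b] ab by (intro exI[of _ z]) (auto simp: algebra_simps)
        next
          case 3
          then show ?thesis using B[of a] ab by (intro exI[of _ "f a"]) auto
        qed
      qed
      then obtain \<xi> where xi: "\<bar>\<xi> - f a\<bar> \<le> \<bar>f b - f a\<bar>" "\<xi> \<in> {-B..B}"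
        "\<Psi> (f b) - \<Psi> (f a) = (f b - f a) * \<Psi>' \<xi>" by blast
      have "\<Psi> (f b) - \<Psi> (f a) - integral {a..b} k = integral {a..b} (\<lambda>t. \<Psi>' \<xi> * g t) - integral {a..b} k"
        using xi(3) ac_diff_integral[OF fg, of a b] ab by simp
      also have "\<dots> = integral {a..b} (\<lambda>t. \<Psi>' \<xi> * g t - k t)"
        using ab by (intro integral_diff[symmetric] L1_int Lk L1_cmult Lg) auto
      finally have eq: "\<Psi> (f b) - \<Psi> (f a) - integral {a..b} k = integral {a..b} (\<lambda>t. \<Psi>' \<xi> * g t - k t)" .
      have "\<bar>\<Psi> (f b) - \<Psi> (f a) - integral {a..b} k\<bar> \<le> integral {a..b} (\<lambda>t. \<epsilon> * \<bar>g t\<bar>)"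
      proof -
        have "norm (integral {a..b} (\<lambda>t. \<Psi>' \<xi> * g t - k t)) \<le> integral {a..b} (\<lambda>t. \<epsilon> * \<bar>g t\<bar>)"
        proof (rule integral_norm_bound_integral)
          fix t assume t: "t \<in> {a..b}"
          have "\<bar>f a - f t\<bar> < r / 2" using \<delta>(2)[of t a] t ab by (simp add: dist_real_def)
          then have "\<bar>\<xi> - f t\<bar> < r" using xi(1) fab by linarith
          then have "\<bar>\<Psi>' \<xi> - \<Psi>' (f t)\<bar> < \<epsilon>"
            using xi(2) B[of t] t ab r(2)[of "f t" \<xi>] by (auto simp: abs_le_iff dist_real_def)
          then have "\<bar>\<Psi>' \<xi> - \<Psi>' (f t)\<bar> * \<bar>g t\<bar> \<le> \<epsilon> * \<bar>g t\<bar>" by (intro mult_right_mono) auto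
          then show "norm (\<Psi>' \<xi> * g t - k t) \<le> \<epsilon> * \<bar>g t\<bar>"
            by (simp add: k_def left_diff_distrib[symmetric] abs_mult)
        qed (use ab in \<open>(intro L1_int L1_diff L1_cmult Lg Lk L1_abs; simp)+\<close>)
        then show ?thesis unfolding eq real_norm_def .
      qed
      also have "\<dots> = \<epsilon> * (\<mu> b - \<mu> a)"
        using ac_diff_integral[OF ac_integral[OF L1_abs[OF Lg], of 0], of a b] ab by (simp add: \<mu>_def)
      finally show ?thesis .
    qed
    then show ?thesis using \<delta>(1) by blast
  qed
  have Dk: "integral {0..b} k - integral {0..a} k = integral {a..b} k" if "0 \<le> a" "a \<le> b" "b \<le> 1" for a b
    using ac_diff_integral[OF ac_integral[OF Lk, of 0], of a b] that by simp
  have "\<Psi> (f x) = \<Psi> (f 0) + integral {0..x} k" if x: "x \<in> {0..1}" for x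
  proof -
    have "\<Psi> (f 0) - integral {0..0} k \<le> \<Psi> (f x) - integral {0..x} k"
    proof (rule nondecreasing_if_locally_up_to_eps[where \<mu> = \<mu> and \<Phi> = "\<lambda>x. \<Psi> (f x) - integral {0..x} k"])
      fix \<epsilon> :: real assume "\<epsilon> > 0"
      then obtain \<delta> where \<delta>: "\<delta> > 0"
        "\<And>a b. 0 \<le> a \<and> a \<le> b \<and> b \<le> 1 \<and> b - a < \<delta> \<Longrightarrow> \<bar>\<Psi> (f b) - \<Psi> (f a) - integral {a..b} k\<bar> \<le> \<epsilon> * (\<mu> b - \<mu> a)"
        using loc by blast
      show "\<exists>\<delta>>0. \<forall>a b. 0 \<le> a \<and> a \<le> b \<and> b \<le> 1 \<and> b - a < \<delta> \<longrightarrow>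
           \<Psi> (f a) - integral {0..a} k \<le> \<Psi> (f b) - integral {0..b} k + \<epsilon> * (\<mu> b - \<mu> a)"
      proof (intro exI[of _ \<delta>] conjI \<delta>(1) allI impI)
        fix a b assume ab: "0 \<le> a \<and> a \<le> b \<and> b \<le> 1 \<and> b - a < \<delta>"
        show "\<Psi> (f a) - integral {0..a} k \<le> \<Psi> (f b) - integral {0..b} k + \<epsilon> * (\<mu> b - \<mu> a)"
          using \<delta>(2)[OF ab] Dk[of a b] ab by linarith
      qed
    qed (use x in auto)
    moreover have "- (\<Psi> (f 0) - integral {0..0} k) \<le> - (\<Psi> (f x) - integral {0..x} k)"
    proof (rule nondecreasing_if_locally_up_to_eps[where \<mu> = \<mu> and \<Phi> = "\<lambda>x. - (\<Psi> (f x) - integral {0..x} k)"])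
      fix \<epsilon> :: real assume "\<epsilon> > 0"
      then obtain \<delta> where \<delta>: "\<delta> > 0"
        "\<And>a b. 0 \<le> a \<and> a \<le> b \<and> b \<le> 1 \<and> b - a < \<delta> \<Longrightarrow> \<bar>\<Psi> (f b) - \<Psi> (f a) - integral {a..b} k\<bar> \<le> \<epsilon> * (\<mu> b - \<mu> a)"
        using loc by blast
      show "\<exists>\<delta>>0. \<forall>a b. 0 \<le> a \<and> a \<le> b \<and> b \<le> 1 \<and> b - a < \<delta> \<longrightarrow>
           - (\<Psi> (f a) - integral {0..a} k) \<le> - (\<Psi> (f b) - integral {0..b} k) + \<epsilon> * (\<mu> b - \<mu> a)"
      proof (intro exI[of _ \<delta>] conjI \<delta>(1) allI impI)
        fix a b assume ab: "0 \<le> a \<and> a \<le> b \<and> b \<le> 1 \<and> b - a < \<delta>"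
        show "- (\<Psi> (f a) - integral {0..a} k) \<le> - (\<Psi> (f b) - integral {0..b} k) + \<epsilon> * (\<mu> b - \<mu> a)"
          using \<delta>(2)[OF ab] Dk[of a b] ab by linarith
      qed
    qed (use x in auto)
    ultimately show ?thesis by simp
  qed
  then have "ac (\<lambda>x. \<Psi> (f x)) k" by (rule acI[OF Lk])
  then show ?thesis unfolding k_def .
qed

lemma ac_exp: "ac f g \<Longrightarrow> ac (\<lambda>x. exp (f x)) (\<lambda>x. exp (f x) * g x)"
  by (rule ac_chain[of f g exp exp]) (auto intro!: derivative_eq_intros continuous_intros)

lemma ac_sin: "ac f g \<Longrightarrow> ac (\<lambda>x. sin (f x)) (\<lambda>x. cos (f x) * g x)"
  by (rule ac_chain[of f g sin cos]) (auto intro!: derivative_eq_intros continuous_intros)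

lemma ac_cos: "ac f g \<Longrightarrow> ac (\<lambda>x. cos (f x)) (\<lambda>x. - sin (f x) * g x)"
  by (rule ac_chain[of f g cos "\<lambda>u. - sin u"]) (auto intro!: derivative_eq_intros continuous_intros)

text \<open>Polarization: four times the product is a difference of two squares, and squares are
  covered by the chain rule.\<close>

lemma ac_mult:
  assumes "ac f g" "ac u v"
  shows "ac (\<lambda>x. f x * u x) (\<lambda>x. g x * u x + f x * v x)"
proof -
  have sq: "ac (\<lambda>x. (h x)^2) (\<lambda>x. (2 * h x) * h' x)" if "ac h h'" for h h'
    by (rule ac_chain[OF that, of "\<lambda>u. u^2" "\<lambda>u. 2 * u"]) (auto intro!: derivative_eq_intros continuous_intros)
  have "ac (\<lambda>x. (1/4) * ((f x + u x)^2 - (f x - u x)^2))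
           (\<lambda>x. (1/4) * (2 * (f x + u x) * (g x + v x) - 2 * (f x - u x) * (g x - v x)))"
    by (rule ac_cmult[OF ac_diff[OF sq[OF ac_add[OF assms]] sq[OF ac_diff[OF assms]]]])
  then show ?thesis
    by (rule ac_cong) (auto simp: power2_eq_square algebra_simps)
qed

section \<open>The Pruefer angle\<close>

text \<open>The value 1 at 0 makes the quotient continuous, so it can enter integrable kernels even
  where two angles coincide.\<close>

definition sinc :: "real \<Rightarrow> real" where
  "sinc x = (if x = 0 then 1 else sin x / x)"

lemma abs_mult_le:
  fixes a b :: real
  assumes "\<bar>a\<bar> \<le> A" "\<bar>b\<bar> \<le> B"
  shows "\<bar>a * b\<bar> \<le> A * B"
  unfolding abs_mult using assms by (rule mult_mono') auto

lemma sinc_mult: "sinc x * x = sin x"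
  by (simp add: sinc_def)

lemma abs_sinc_le: "\<bar>sinc x\<bar> \<le> 1"
  using abs_sin_x_le_abs_x[of x] by (auto simp: sinc_def divide_le_eq)

lemma abs_sinc_minus_1_le: "\<bar>sinc x - 1\<bar> \<le> \<bar>x\<bar>"
proof -
  have "\<exists>\<xi>. \<bar>\<xi>\<bar> \<le> \<bar>x\<bar> \<and> sinc x = cos \<xi>"
  proof -
    consider "x = 0" | "0 < x" | "x < 0" by linarith
    then show ?thesis
    proof cases
      case 1
      then show ?thesis by (auto simp: sinc_def)
    next
      case 2
      then obtain z where "0 < z" "z < x" "sin x - sin 0 = (x - 0) * cos z"
        using MVT2[of 0 x sin cos] by (auto intro: DERIV_sin)
      then show ?thesis using 2 by (intro exI[of _ z]) (auto simp: sinc_def field_simps)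
    next
      case 3
      then obtain z where "x < z" "z < 0" "sin 0 - sin x = (0 - x) * cos z"
        using MVT2[of x 0 sin cos] by (auto intro: DERIV_sin)
      then show ?thesis using 3 by (intro exI[of _ z]) (auto simp: sinc_def field_simps)
    qed
  qed
  then obtain \<xi> where xi: "\<bar>\<xi>\<bar> \<le> \<bar>x\<bar>" "sinc x = cos \<xi>" by blast
  have "cos \<xi> = 1 - 2 * (sin (\<xi>/2))\<^sup>2"
    using cos_double_sin[of "\<xi>/2"] by simp
  then have "\<bar>sinc x - 1\<bar> = 2 * (\<bar>sin (\<xi>/2)\<bar> * \<bar>sin (\<xi>/2)\<bar>)"
    by (simp add: xi(2) power2_eq_square)
  also have "\<dots> \<le> 2 * (\<bar>\<xi>/2\<bar> * 1)"
    by (intro mult_left_mono mult_mono abs_sin_x_le_abs_x) auto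
  finally show ?thesis using xi(1) by simp
qed

lemma continuous_on_sinc: "continuous_on S sinc"
proof -
  have "isCont sinc x" for x
  proof (cases "x = 0")
    case True
    have "((\<lambda>h. (sin (0 + h) - sin 0) / h) \<longlongrightarrow> cos 0) (at (0::real))"
      using DERIV_sin[of "0::real"] unfolding DERIV_def by simp
    then have "((\<lambda>h. (sin (0 + h) - sin 0) / h) \<longlongrightarrow> 1) (at (0::real))" by simp
    then have "(sinc \<longlongrightarrow> 1) (at 0)"
      by (rule Lim_transform_eventually) (auto simp: sinc_def eventually_at intro: exI[of _ 1])
    then show ?thesis by (simp add: isCont_def True sinc_def)
  next
    case False
    have "isCont (\<lambda>x. sin x / x) x" using False by (intro continuous_intros) auto
    moreover have "eventually (\<lambda>y. sin y / y = sinc y) (nhds x)"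
      by (rule eventually_mono[OF t1_space_nhds[OF False]]) (auto simp: sinc_def)
    ultimately show ?thesis using isCont_cong by fast
  qed
  then show ?thesis by (simp add: continuous_at_imp_continuous_on)
qed

lemma sin_squared_diff:
  fixes a b :: real
  shows "(sin a)\<^sup>2 - (sin b)\<^sup>2 = sin (a + b) * sin (a - b)"
proof -
  have "sin (a + b) * sin (a - b) = (sin a * cos b)\<^sup>2 - (cos a * sin b)\<^sup>2"
    by (simp add: sin_add sin_diff power2_eq_square algebra_simps)
  also have "\<dots> = (sin a)\<^sup>2 * (1 - (sin b)\<^sup>2) - (1 - (sin a)\<^sup>2) * (sin b)\<^sup>2"
    by (simp add: power_mult_distrib cos_squared_eq)
  finally show ?thesis by (simp add: algebra_simps)
qed

text \<open>Right-hand side of the equation for the Pruefer angle \<open>\<theta>\<close> of \<open>y'' = - p y\<close>, where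
  \<open>y = \<rho> sin \<theta>\<close> and \<open>y' = \<rho> cos \<theta>\<close>.\<close>
definition pruefer_rhs :: "real \<Rightarrow> real \<Rightarrow> real" where
  "pruefer_rhs p u = (cos u)\<^sup>2 + p * (sin u)\<^sup>2"

text \<open>Replacing \<open>cos\<^sup>2\<close> by \<open>1 - sin\<^sup>2\<close> leaves
  \<open>p - 1\<close> times a difference of squared sines, which factors exactly. So the difference
  of two angles obeys a linear equation without any linearization error.\<close>

lemma pruefer_rhs_diff:
  "pruefer_rhs p u - pruefer_rhs p v = (p - 1) * (sin (u + v) * sinc (u - v)) * (u - v)"
proof -
  have "pruefer_rhs p u - pruefer_rhs p v = (p - 1) * ((sin u)\<^sup>2 - (sin v)\<^sup>2)"
    by (simp add: pruefer_rhs_def cos_squared_eq algebra_simps)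
  then show ?thesis by (simp add: sin_squared_diff sinc_mult mult.assoc)
qed

lemma L1_pruefer_rhs:
  assumes "L1 p" "continuous_on {0..1} u"
  shows "L1 (\<lambda>t. pruefer_rhs (p t) (u t))"
  unfolding pruefer_rhs_def
  by (intro L1_add L1_mult_continuous(2)[OF assms(1)] L1_continuous continuous_intros assms(2))

lemma abs_pruefer_rhs_diff_le: "\<bar>pruefer_rhs p u - pruefer_rhs p v\<bar> \<le> (1 + \<bar>p\<bar>) * \<bar>u - v\<bar>"
proof -
  have "\<bar>sin (u + v) * sinc (u - v)\<bar> \<le> 1 * 1"
    by (intro abs_mult_le abs_sinc_le abs_sin_le_one)
  then have "\<bar>p - 1\<bar> * \<bar>sin (u + v) * sinc (u - v)\<bar> \<le> (1 + \<bar>p\<bar>) * 1"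
    by (intro mult_mono) auto
  then show ?thesis
    unfolding pruefer_rhs_diff abs_mult[of _ "u - v"] abs_mult[of "p - 1"] by (intro mult_right_mono) auto
qed

section \<open>Existence and comparison of angles\<close>

text \<open>The integrating factor removes the homogeneous term, so that the source \<open>e\<close>
  alone governs the growth.\<close>

lemma variation_of_constants:
  assumes d: "ac d (\<lambda>t. k t * d t + e t)" and k: "L1 k"
  shows "ac (\<lambda>x. exp (- integral {0..x} k) * d x) (\<lambda>t. exp (- integral {0..t} k) * e t)"
proof -
  have "ac (\<lambda>x. exp (-1 * (0 + integral {0..x} k)))
           (\<lambda>x. exp (-1 * (0 + integral {0..x} k)) * (-1 * k x))"
    by (rule ac_exp[OF ac_cmult[OF ac_integral[OF k]]])
  from ac_mult[OF this d] show ?thesis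
    by (rule ac_cong) (auto simp: algebra_simps)
qed

text \<open>A fixed point of the Picard operator, contractive in the norm weighted by
  \<open>exp (-2 P)\<close> with \<open>P\<close> a primitive of the Lipschitz constant.\<close>
lemma pruefer_exists:
  assumes p: "L1 p"
  shows "\<exists>\<theta>. ac \<theta> (\<lambda>t. pruefer_rhs (p t) (\<theta> t)) \<and> \<theta> 0 = a"
proof -
  define k where "k = (\<lambda>t. 1 + \<bar>p t\<bar>)"
  have k: "L1 k" unfolding k_def by (intro L1_add L1_abs p L1_continuous continuous_intros)
  \<comment> \<open>The factor 2 produces the contraction ratio 1/2, since \<open>exp P\<close> has
    derivative \<open>2 k exp P\<close>.\<close>
  define P where "P = (\<lambda>x. 2 * (0 + integral {0..x} k))"
  have acP: "ac P (\<lambda>x. 2 * k x)" unfolding P_def by (intro ac_cmult ac_integral k)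
  have P0: "P 0 = 0" by (simp add: P_def)
  have contP: "continuous_on {0..1} P" by (rule ac_continuous[OF acP])
  \<comment> \<open>Clamping to [0,1] turns functions on the interval into bounded continuous
    functions on the line, a complete space in which the fixed point theorem applies.\<close>
  define c where "c = (\<lambda>x::real. max 0 (min 1 x))"
  have c: "c x \<in> {0..1}" for x by (auto simp: c_def)
  have cc: "continuous_on UNIV c" unfolding c_def by (intro continuous_intros)
  \<comment> \<open>The unknown \<open>g\<close> stands for \<open>exp (- P) \<theta>\<close>, so
    its plain supremum norm is the weighted norm of the angle.\<close>
  define I where "I = (\<lambda>g x. a + integral {0..x} (\<lambda>t. pruefer_rhs (p t) (exp (P t) * g t)))"
  have Lg: "L1 (\<lambda>t. pruefer_rhs (p t) (exp (P t) * apply_bcontfun g t))" for g :: "real \<Rightarrow>\<^sub>C real"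
    by (intro L1_pruefer_rhs p continuous_intros contP continuous_on_apply_bcontfun)
  have acI: "ac (I (apply_bcontfun g)) (\<lambda>t. pruefer_rhs (p t) (exp (P t) * apply_bcontfun g t))" for g :: "real \<Rightarrow>\<^sub>C real"
    unfolding I_def by (rule ac_integral[OF Lg])
  define S0 where "S0 = (\<lambda>g x. exp (- P (c x)) * I g (c x))"
  have S0: "S0 (apply_bcontfun g) \<in> bcontfun" for g :: "real \<Rightarrow>\<^sub>C real"
  proof -
    have 1: "continuous_on {0..1} (\<lambda>x. exp (- P x) * I (apply_bcontfun g) x)"
      by (intro continuous_intros contP ac_continuous[OF acI])
    have "continuous_on UNIV (S0 (apply_bcontfun g))"
      unfolding S0_def by (rule continuous_on_compose2[OF 1 cc]) (use c in auto)
    moreover have "range (S0 (apply_bcontfun g)) \<subseteq> (\<lambda>x. exp (- P x) * I (apply_bcontfun g) x) ` {0..1}"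
      using c by (auto simp: S0_def)
    then have "bounded (range (S0 (apply_bcontfun g)))"
      by (rule bounded_subset[OF compact_imp_bounded[OF compact_continuous_image[OF 1 compact_Icc]]])
    ultimately show ?thesis by (simp add: bcontfun_def)
  qed
  define S where "S = (\<lambda>g :: real \<Rightarrow>\<^sub>C real. Bcontfun (S0 (apply_bcontfun g)))"
  have S: "apply_bcontfun (S g) = S0 (apply_bcontfun g)" for g
    unfolding S_def by (rule Bcontfun_inverse[OF S0])
  have contr: "dist (S g) (S h) \<le> (1/2) * dist g h" for g h
  proof (rule dist_bound)
    fix x :: real
    define D where "D = dist g h"
    define y where "y = c x"
    have y: "y \<in> {0..1}" using c y_def by auto
    have D0: "D \<ge> 0" by (simp add: D_def)
    have acE: "ac (\<lambda>x. (D/2) * exp (P x)) (\<lambda>x. (D/2) * (exp (P x) * (2 * k x)))"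
      by (rule ac_cmult[OF ac_exp[OF acP]])
    have "\<bar>I g y - I h y\<bar> = \<bar>integral {0..y} (\<lambda>t. pruefer_rhs (p t) (exp (P t) * g t) - pruefer_rhs (p t) (exp (P t) * h t))\<bar>"
      unfolding I_def using y by (subst integral_diff) (auto intro: L1_int[OF Lg])
    also have "\<dots> \<le> integral {0..y} (\<lambda>x. (D/2) * (exp (P x) * (2 * k x)))"
    proof -
      have "norm (integral {0..y} (\<lambda>t. pruefer_rhs (p t) (exp (P t) * g t) - pruefer_rhs (p t) (exp (P t) * h t)))
          \<le> integral {0..y} (\<lambda>x. (D/2) * (exp (P x) * (2 * k x)))"
      proof (rule integral_norm_bound_integral)
        show "(\<lambda>t. pruefer_rhs (p t) (exp (P t) * g t) - pruefer_rhs (p t) (exp (P t) * h t)) integrable_on {0..y}"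
          using y by (intro L1_int L1_diff Lg) auto
        show "(\<lambda>x. (D/2) * (exp (P x) * (2 * k x))) integrable_on {0..y}"
          using y by (intro L1_int ac_L1[OF acE]) auto
        fix t
        have "dist (g t) (h t) \<le> D" unfolding D_def by (rule dist_bounded)
        then have "\<bar>exp (P t) * g t - exp (P t) * h t\<bar> \<le> exp (P t) * D"
          by (simp add: right_diff_distrib[symmetric] abs_mult dist_real_def)
        then have "(1 + \<bar>p t\<bar>) * \<bar>exp (P t) * g t - exp (P t) * h t\<bar> \<le> (1 + \<bar>p t\<bar>) * (exp (P t) * D)"
          by (intro mult_left_mono) auto
        then show "norm (pruefer_rhs (p t) (exp (P t) * g t) - pruefer_rhs (p t) (exp (P t) * h t))
                    \<le> (D/2) * (exp (P t) * (2 * k t))"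
          using abs_pruefer_rhs_diff_le[of "p t" "exp (P t) * g t" "exp (P t) * h t"]
          by (simp add: k_def algebra_simps)
      qed
      then show ?thesis by simp
    qed
    also have "\<dots> = (D/2) * exp (P y) - D/2"
      using ac_diff_integral[OF acE, of 0 y] y P0 by simp
    also have "\<dots> \<le> (D/2) * exp (P y)" using D0 by simp
    finally have "exp (- P y) * \<bar>I g y - I h y\<bar> \<le> exp (- P y) * ((D/2) * exp (P y))"
      by (intro mult_left_mono) auto
    also have "\<dots> = D/2" by (simp add: exp_minus)
    finally show "dist (apply_bcontfun (S g) x) (apply_bcontfun (S h) x) \<le> (1/2) * dist g h"
      by (simp add: S S0_def y_def[symmetric] dist_real_def right_diff_distrib[symmetric] abs_mult D_def)
  qed
  have "\<exists>!g. S g = g"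
    by (rule banach_fix_type[of "1/2"]) (use contr in auto)
  then obtain g where g: "S g = g" by blast
  have fp: "exp (P x) * apply_bcontfun g x = I (apply_bcontfun g) x" if "x \<in> {0..1}" for x
  proof -
    have "c x = x" using that by (auto simp: c_def)
    moreover have "apply_bcontfun g x = S0 (apply_bcontfun g) x" using S[of g] g by simp
    ultimately show ?thesis by (simp add: S0_def exp_minus)
  qed
  have "ac (\<lambda>x. exp (P x) * apply_bcontfun g x) (\<lambda>t. pruefer_rhs (p t) (exp (P t) * apply_bcontfun g t))"
    by (rule ac_cong[OF acI[of g]]) (use fp in auto)
  moreover have "exp (P 0) * apply_bcontfun g 0 = a"
    using fp[of 0] by (simp add: I_def)
  ultimately show ?thesis by blast
qed

text \<open>Logarithmic derivative of the difference of two Pruefer angles for the same \<open>p\<close>;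
  the quotient \<open>sin s / s\<close> linearizes the difference of the right-hand sides.\<close>
definition pkernel :: "(real \<Rightarrow> real) \<Rightarrow> (real \<Rightarrow> real) \<Rightarrow> (real \<Rightarrow> real) \<Rightarrow> real \<Rightarrow> real" where
  "pkernel p \<theta> \<phi> t = (p t - 1) * (sin (\<phi> t + \<theta> t) * sinc (\<phi> t - \<theta> t))"

lemma L1_pkernel:
  assumes "L1 p" "continuous_on {0..1} \<theta>" "continuous_on {0..1} \<phi>"
  shows "L1 (pkernel p \<theta> \<phi>)"
  unfolding pkernel_def
  by (intro L1_mult_continuous(2) L1_diff assms L1_continuous continuous_intros
      continuous_on_compose2[OF continuous_on_sinc[of UNIV]]) auto

lemma abs_pkernel_le: "\<bar>pkernel p \<theta> \<phi> t\<bar> \<le> 1 + \<bar>p t\<bar>"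
proof -
  have "\<bar>sin (\<phi> t + \<theta> t) * sinc (\<phi> t - \<theta> t)\<bar> \<le> 1 * 1"
    by (intro abs_mult_le abs_sinc_le abs_sin_le_one)
  then have "\<bar>p t - 1\<bar> * \<bar>sin (\<phi> t + \<theta> t) * sinc (\<phi> t - \<theta> t)\<bar> \<le> (1 + \<bar>p t\<bar>) * 1"
    by (intro mult_mono) auto
  then show ?thesis by (simp add: pkernel_def abs_mult)
qed

text \<open>The intermediate term with coefficient \<open>p2\<close> and angle
  \<open>\<theta>\<close> splits the difference: changing the angle gives the kernel, changing the
  coefficient gives the source. The terms \<open>r1\<close> and \<open>r2\<close> admit functions
  that satisfy the angle equation only up to a surplus, such as supersolutions and
  constants.\<close>

lemma pruefer_difference:
  assumes \<theta>: "ac \<theta> (\<lambda>t. pruefer_rhs (p1 t) (\<theta> t) + r1 t)"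
    and \<phi>: "ac \<phi> (\<lambda>t. pruefer_rhs (p2 t) (\<phi> t) + r2 t)" and p2: "L1 p2"
  shows "ac (\<lambda>x. exp (- integral {0..x} (pkernel p2 \<theta> \<phi>)) * (\<phi> x - \<theta> x))
            (\<lambda>t. exp (- integral {0..t} (pkernel p2 \<theta> \<phi>)) * ((p2 t - p1 t) * (sin (\<theta> t))\<^sup>2 + (r2 t - r1 t)))"
proof (rule variation_of_constants)
  show "L1 (pkernel p2 \<theta> \<phi>)"
    by (intro L1_pkernel p2 ac_continuous[OF \<theta>] ac_continuous[OF \<phi>])
  show "ac (\<lambda>x. \<phi> x - \<theta> x) (\<lambda>t. pkernel p2 \<theta> \<phi> t * (\<phi> t - \<theta> t) + ((p2 t - p1 t) * (sin (\<theta> t))\<^sup>2 + (r2 t - r1 t)))"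
  proof (rule ac_cong[OF ac_diff[OF \<phi> \<theta>]])
    fix t
    have "pruefer_rhs (p2 t) (\<phi> t) - pruefer_rhs (p2 t) (\<theta> t) = pkernel p2 \<theta> \<phi> t * (\<phi> t - \<theta> t)"
      by (simp add: pruefer_rhs_diff pkernel_def)
    moreover have "pruefer_rhs (p2 t) (\<theta> t) - pruefer_rhs (p1 t) (\<theta> t) = (p2 t - p1 t) * (sin (\<theta> t))\<^sup>2"
      by (simp add: pruefer_rhs_def algebra_simps)
    ultimately show "pruefer_rhs (p2 t) (\<phi> t) + r2 t - (pruefer_rhs (p1 t) (\<theta> t) + r1 t) =
      pkernel p2 \<theta> \<phi> t * (\<phi> t - \<theta> t) + ((p2 t - p1 t) * (sin (\<theta> t))\<^sup>2 + (r2 t - r1 t))"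
      by linarith
  qed simp
qed

text \<open>A nonnegative source makes the difference times its positive integrating factor
  nondecreasing, so the sign at 0 persists.\<close>

lemma pruefer_compare:
  assumes \<theta>: "ac \<theta> (\<lambda>t. pruefer_rhs (p1 t) (\<theta> t) + r1 t)"
    and \<phi>: "ac \<phi> (\<lambda>t. pruefer_rhs (p2 t) (\<phi> t) + r2 t)" and p2: "L1 p2"
    and nonneg: "\<And>t. t \<in> {0..1} \<Longrightarrow> 0 \<le> (p2 t - p1 t) * (sin (\<theta> t))\<^sup>2 + (r2 t - r1 t)"
    and init: "\<theta> 0 \<le> \<phi> 0" and x: "x \<in> {0..1}"
  shows "\<theta> x \<le> \<phi> x"
proof -
  let ?E = "\<lambda>x. exp (- integral {0..x} (pkernel p2 \<theta> \<phi>))"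
  have "?E 0 * (\<phi> 0 - \<theta> 0) \<le> ?E x * (\<phi> x - \<theta> x)"
    by (rule ac_mono[OF pruefer_difference[OF \<theta> \<phi> p2]]) (use nonneg x in auto)
  then have "0 \<le> ?E x * (\<phi> x - \<theta> x)" using init by simp
  then show ?thesis by (simp add: zero_le_mult_iff)
qed

lemma abs_integral_pkernel_le:
  assumes "L1 p" "continuous_on {0..1} \<theta>" "continuous_on {0..1} \<phi>" "x \<in> {0..1}"
  shows "\<bar>integral {0..x} (pkernel p \<theta> \<phi>)\<bar> \<le> 1 + integral {0..1} (\<lambda>t. \<bar>p t\<bar>)"
proof -
  have L: "L1 (pkernel p \<theta> \<phi>)" by (rule L1_pkernel[OF assms(1-3)])
  have "\<bar>integral {0..x} (pkernel p \<theta> \<phi>)\<bar> \<le> integral {0..x} (\<lambda>t. \<bar>pkernel p \<theta> \<phi> t\<bar>)"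
    using assms(4) by (intro L1_integral_abs_mono L) auto
  also have "\<dots> \<le> integral {0..1} (\<lambda>t. \<bar>pkernel p \<theta> \<phi> t\<bar>)"
    using assms(4) by (intro L1_integral_abs_le L) auto
  also have "\<dots> \<le> integral {0..1} (\<lambda>t. 1 + \<bar>p t\<bar>)"
    by (intro integral_le L1_int L1_abs L L1_add L1_continuous assms(1) abs_pkernel_le) auto
  also have "\<dots> = 1 + integral {0..1} (\<lambda>t. \<bar>p t\<bar>)"
    by (subst integral_add) (auto intro: L1_int L1_abs assms(1))
  finally show ?thesis .
qed

section \<open>The angle as a function of the coefficient\<close>

definition pangle :: "real \<Rightarrow> (real \<Rightarrow> real) \<Rightarrow> real \<Rightarrow> real" where
  "pangle a p = (SOME \<theta>. ac \<theta> (\<lambda>t. pruefer_rhs (p t) (\<theta> t)) \<and> \<theta> 0 = a)"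

lemma pangle:
  assumes "L1 p"
  shows "ac (pangle a p) (\<lambda>t. pruefer_rhs (p t) (pangle a p t))" "pangle a p 0 = a"
  using someI_ex[OF pruefer_exists[OF assms, of a]] unfolding pangle_def by blast+

lemma pangle': "L1 p \<Longrightarrow> ac (pangle a p) (\<lambda>t. pruefer_rhs (p t) (pangle a p t) + 0)"
  using pangle(1) by simp

lemma continuous_on_pangle: "L1 p \<Longrightarrow> continuous_on {0..1} (pangle a p)"
  using pangle(1) ac_continuous by blast

text \<open>Integrating factor for the difference of the angles of \<open>p2\<close> and
  \<open>p1\<close>. On the diagonal \<open>p1 = p2\<close> the kernel is
  \<open>(p - 1) sin (2 \<theta>)\<close>, and the factor is the squared amplitude of the solution
  whose amplitude at 0 is 1.\<close>

definition pfactor :: "real \<Rightarrow> (real \<Rightarrow> real) \<Rightarrow> (real \<Rightarrow> real) \<Rightarrow> real \<Rightarrow> real" where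
  "pfactor a p1 p2 x = exp (- integral {0..x} (pkernel p2 (pangle a p1) (pangle a p2)))"

lemma pfactor_bounds:
  assumes "L1 p1" "L1 p2" "x \<in> {0..1}" "integral {0..1} (\<lambda>t. \<bar>p2 t\<bar>) \<le> B"
  shows "exp (- (1 + B)) \<le> pfactor a p1 p2 x" "pfactor a p1 p2 x \<le> exp (1 + B)" "0 < pfactor a p1 p2 x"
  using abs_integral_pkernel_le[OF assms(2) continuous_on_pangle[OF assms(1), of a] continuous_on_pangle[OF assms(2), of a] assms(3)]
    assms(4)
  by (auto simp: pfactor_def)

lemma pfactor_difference:
  assumes "L1 p1" "L1 p2"
  shows "ac (\<lambda>x. pfactor a p1 p2 x * (pangle a p2 x - pangle a p1 x))
            (\<lambda>t. pfactor a p1 p2 t * ((p2 t - p1 t) * (sin (pangle a p1 t))\<^sup>2))"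
  using pruefer_difference[OF pangle'[OF assms(1)] pangle'[OF assms(2)] assms(2)]
  by (simp add: pfactor_def)

lemma pangle_difference:
  assumes "L1 p1" "L1 p2" "x \<in> {0..1}"
  shows "pfactor a p1 p2 x * (pangle a p2 x - pangle a p1 x) =
         integral {0..x} (\<lambda>t. pfactor a p1 p2 t * ((p2 t - p1 t) * (sin (pangle a p1 t))\<^sup>2))"
  using ac_eq[OF pfactor_difference[OF assms(1,2)] assms(3)] pangle(2) assms(1,2) by simp

text \<open>One factor \<open>exp (1 + B)\<close> bounds the integrating factor under the integral,
  the other one divides it out at \<open>x\<close>.\<close>

lemma pangle_lipschitz:
  assumes "L1 p1" "L1 p2" "x \<in> {0..1}" "integral {0..1} (\<lambda>t. \<bar>p2 t\<bar>) \<le> B"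
  shows "\<bar>pangle a p2 x - pangle a p1 x\<bar> \<le> exp (2 * (1 + B)) * integral {0..1} (\<lambda>t. \<bar>p2 t - p1 t\<bar>)"
proof -
  let ?g = "\<lambda>t. pfactor a p1 p2 t * ((p2 t - p1 t) * (sin (pangle a p1 t))\<^sup>2)"
  let ?d = "pangle a p2 x - pangle a p1 x"
  have L: "L1 ?g" by (rule ac_L1[OF pfactor_difference[OF assms(1,2)]])
  have "\<bar>pfactor a p1 p2 x * ?d\<bar> \<le> integral {0..x} (\<lambda>t. \<bar>?g t\<bar>)"
    unfolding pangle_difference[OF assms(1-3)] using assms(3) by (intro L1_integral_abs_mono L) auto
  also have "\<dots> \<le> integral {0..1} (\<lambda>t. \<bar>?g t\<bar>)" using assms(3) by (intro L1_integral_abs_le L) auto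
  also have "\<dots> \<le> integral {0..1} (\<lambda>t. exp (1 + B) * \<bar>p2 t - p1 t\<bar>)"
  proof (intro integral_le L1_int L1_abs L L1_cmult L1_diff assms(1,2))
    fix t :: real assume t: "t \<in> {0..1}"
    have "\<bar>p2 t - p1 t\<bar> * (sin (pangle a p1 t))\<^sup>2 \<le> \<bar>p2 t - p1 t\<bar> * 1"
      by (intro mult_left_mono) (auto simp: abs_square_le_1)
    then have "pfactor a p1 p2 t * (\<bar>p2 t - p1 t\<bar> * (sin (pangle a p1 t))\<^sup>2) \<le> exp (1 + B) * (\<bar>p2 t - p1 t\<bar> * 1)"
      using pfactor_bounds[OF assms(1,2) t assms(4), of a]
      by (intro mult_mono mult_nonneg_nonneg) (auto simp: abs_square_le_1)
    then show "\<bar>?g t\<bar> \<le> exp (1 + B) * \<bar>p2 t - p1 t\<bar>"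
      using pfactor_bounds(3)[OF assms(1,2) t assms(4), of a] by (simp add: abs_mult)
  qed auto
  also have "\<dots> = exp (1 + B) * integral {0..1} (\<lambda>t. \<bar>p2 t - p1 t\<bar>)" by simp
  finally have 1: "pfactor a p1 p2 x * \<bar>?d\<bar> \<le> exp (1 + B) * integral {0..1} (\<lambda>t. \<bar>p2 t - p1 t\<bar>)"
    using pfactor_bounds(3)[OF assms, of a] by (simp add: abs_mult)
  have "exp (- (1 + B)) * \<bar>?d\<bar> \<le> pfactor a p1 p2 x * \<bar>?d\<bar>"
    using pfactor_bounds(1)[OF assms] by (intro mult_right_mono) auto
  then have "exp (- (1 + B)) * \<bar>?d\<bar> \<le> exp (1 + B) * integral {0..1} (\<lambda>t. \<bar>p2 t - p1 t\<bar>)" using 1 by linarith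
  then have "exp (1 + B) * (exp (- (1 + B)) * \<bar>?d\<bar>) \<le> exp (1 + B) * (exp (1 + B) * integral {0..1} (\<lambda>t. \<bar>p2 t - p1 t\<bar>))"
    by (intro mult_left_mono) auto
  then show ?thesis by (simp add: mult.assoc[symmetric] exp_add[symmetric])
qed

text \<open>The source is at least \<open>m sin\<^sup>2 \<theta>\<close>, so strictness requires
  that \<open>sin \<theta>\<close> does not vanish identically. Otherwise the angle would have slope
  1, and growing by 1 from a zero of the sine does not lead to another zero.\<close>

lemma pangle_strict_mono:
  assumes p: "L1 p1" "L1 p2" and m: "m > 0" "\<And>t. t \<in> {0..1} \<Longrightarrow> p1 t + m \<le> p2 t"
  shows "pangle a p1 1 < pangle a p2 1"
proof -
  define B where "B = integral {0..1} (\<lambda>t. \<bar>p2 t\<bar>)"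
  define \<theta> where "\<theta> = pangle a p1"
  define S where "S = integral {0..1} (\<lambda>t. (sin (\<theta> t))\<^sup>2)"
  have c\<theta>: "continuous_on {0..1} \<theta>" unfolding \<theta>_def by (rule continuous_on_pangle[OF p(1)])
  have cs: "continuous_on {0..1} (\<lambda>t. (sin (\<theta> t))\<^sup>2)" by (intro continuous_intros c\<theta>)
  have "S \<ge> 0" unfolding S_def by (rule integral_nonneg) (auto intro: integrable_continuous_real cs)
  moreover have "S \<noteq> 0"
  proof
    assume "S = 0"
    then have "((\<lambda>t. (sin (\<theta> t))\<^sup>2) has_integral 0) (cbox 0 1)"
      unfolding S_def using integrable_continuous_real[OF cs] by (auto simp: has_integral_iff)
    then have s0: "sin (\<theta> t) = 0" if "t \<in> {0..1}" for t
      using has_integral_0_cbox_imp_0[of 0 1 "\<lambda>t. (sin (\<theta> t))\<^sup>2" t] cs that by auto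
    have "ac (\<lambda>x. \<theta> x - x) (\<lambda>t. pruefer_rhs (p1 t) (\<theta> t) - 1)"
      unfolding \<theta>_def
      by (intro ac_diff pangle(1) p(1) ac_from_deriv[of "\<lambda>x. x" "\<lambda>x. 1"]) (auto intro!: derivative_eq_intros)
    then have "\<theta> 1 - 1 = \<theta> 0 - 0"
      by (rule ac_zero_const[where f = "\<lambda>x. \<theta> x - x"]) (auto simp: pruefer_rhs_def s0 cos_squared_eq)
    then have "sin (\<theta> 0 + 1) = 0" using s0[of 1] by (simp add: algebra_simps)
    then have "cos (\<theta> 0) * sin 1 = 0" using s0[of 0] by (simp add: sin_add)
    moreover have "sin (1::real) > 0" by (rule sin_gt_zero) (use pi_gt3 in auto)
    moreover have "cos (\<theta> 0) \<noteq> 0" using s0[of 0] sin_cos_squared_add[of "\<theta> 0"] by auto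
    ultimately show False by simp
  qed
  ultimately have S: "S > 0" by simp
  have "0 < exp (- (1 + B)) * m * S" using S m by simp
  also have "\<dots> = integral {0..1} (\<lambda>t. exp (- (1 + B)) * m * (sin (\<theta> t))\<^sup>2)" by (simp add: S_def)
  also have "\<dots> \<le> integral {0..1} (\<lambda>t. pfactor a p1 p2 t * ((p2 t - p1 t) * (sin (\<theta> t))\<^sup>2))"
  proof (rule integral_le)
    show "(\<lambda>t. exp (- (1 + B)) * m * (sin (\<theta> t))\<^sup>2) integrable_on {0..1}"
      by (intro L1_int L1_cmult L1_continuous cs) auto
    show "(\<lambda>t. pfactor a p1 p2 t * ((p2 t - p1 t) * (sin (\<theta> t))\<^sup>2)) integrable_on {0..1}"
      unfolding \<theta>_def by (intro L1_int ac_L1[OF pfactor_difference] p) auto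
    fix t :: real assume t: "t \<in> {0..1}"
    have "exp (- (1 + B)) * (m * (sin (\<theta> t))\<^sup>2) \<le> pfactor a p1 p2 t * ((p2 t - p1 t) * (sin (\<theta> t))\<^sup>2)"
      using pfactor_bounds[OF p t, of B a] m(1) m(2)[OF t]
      by (intro mult_mono mult_right_mono) (auto simp: B_def)
    then show "exp (- (1 + B)) * m * (sin (\<theta> t))\<^sup>2 \<le> pfactor a p1 p2 t * ((p2 t - p1 t) * (sin (\<theta> t))\<^sup>2)"
      by (simp add: mult.assoc)
  qed
  also have "\<dots> = pfactor a p1 p2 1 * (pangle a p2 1 - pangle a p1 1)"
    using pangle_difference[OF p, of 1 a] by (simp add: \<theta>_def)
  finally show ?thesis
    using pfactor_bounds(3)[OF p, of 1 B a] by (simp add: zero_less_mult_iff B_def)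
qed

text \<open>The constant 0 satisfies the angle equation up to the surplus -1, since angles have
  slope 1 where the sine vanishes. The source against it is therefore 1, and the weighted angle has
  the positive factor \<open>?E\<close> itself as derivative.\<close>

lemma pangle_pos:
  assumes p: "L1 p" and a: "0 \<le> a"
  shows "0 < pangle a p 1"
proof -
  define B where "B = integral {0..1} (\<lambda>t. \<bar>p t\<bar>)"
  define \<theta> where "\<theta> = pangle a p"
  let ?E = "\<lambda>x. exp (- integral {0..x} (pkernel p (\<lambda>x. 0) \<theta>))"
  have "ac (\<lambda>x. 0) (\<lambda>t. pruefer_rhs (p t) 0 + -1)" using ac_const[of 0] by (simp add: pruefer_rhs_def)
  from pruefer_difference[OF this pangle'[OF p, of a] p]
  have ac: "ac (\<lambda>x. ?E x * \<theta> x) ?E" by (simp add: \<theta>_def)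
  have E: "exp (- (1 + B)) \<le> ?E x" if "x \<in> {0..1}" for x
    using abs_integral_pkernel_le[OF p _ continuous_on_pangle[OF p, of a], of "\<lambda>x. 0" x] that
    by (simp add: B_def \<theta>_def)
  have "0 < exp (- (1 + B))" by simp
  also have "\<dots> = integral {0..1} (\<lambda>x::real. exp (- (1 + B)))" by simp
  also have "\<dots> \<le> integral {0..1} ?E"
    by (intro integral_le L1_int L1_continuous ac_L1[OF ac] E) auto
  also have "\<dots> = ?E 1 * \<theta> 1 - a"
    using ac_diff_integral[OF ac, of 0 1] pangle(2)[OF p, of a] by (simp add: \<theta>_def)
  finally have "0 < ?E 1 * \<theta> 1" using a by simp
  then show ?thesis by (simp add: zero_less_mult_iff \<theta>_def)
qed

text \<open>The supersolution is the angle with cotangent \<open>R (2 x - 1) + \<integral>\<^sub>0\<^sup>x q\<close>: it starts above \<open>a\<close>, ends below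
  \<open>pi - \<beta>\<close>, and absorbing \<open>q\<close> into the cotangent leaves no trace of \<open>q\<close> in the inequality for \<open>lam\<close>.\<close>
lemma pangle_less_for_very_negative:
  assumes a: "a < pi" and \<beta>: "\<beta> < pi" and m: "m > 0" and M: "M \<ge> 0"
  obtains \<Lambda> where "\<Lambda> > 0" "\<And>w q lam. L1 w \<Longrightarrow> L1 q \<Longrightarrow> \<forall>t\<in>{0..1}. m \<le> w t \<Longrightarrow>
           integral {0..1} (\<lambda>t. \<bar>q t\<bar>) \<le> M \<Longrightarrow> lam \<le> - \<Lambda> \<Longrightarrow> pangle a (\<lambda>t. lam * w t - q t) 1 < pi - \<beta>"
proof -
  have "eventually (\<lambda>r. max (a - pi/2) (\<beta> - pi/2) < arctan r) at_top"
    by (rule order_tendstoD(1)[OF tendsto_arctan_at_top]) (use a \<beta> in \<open>simp add: max_def\<close>)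
  then obtain T where T: "\<And>r. r \<ge> T \<Longrightarrow> max (a - pi/2) (\<beta> - pi/2) < arctan r"
    unfolding eventually_at_top_linorder by blast
  \<comment> \<open>\<open>T\<close> makes \<open>arctan\<close> exceed both \<open>a - pi/2\<close>
    and \<open>\<beta> - pi/2\<close>. The cotangent \<open>v\<close> is \<open>- R\<close> at 0 and
    at least \<open>R - M\<close> at 1; the summand \<open>M\<close> pays for the integral of
    \<open>q\<close>.\<close>
  define R where "R = max T 0 + M"
  have R: "R \<ge> 0" "R \<ge> T" "R - M \<ge> T" using M by (auto simp: R_def)
  \<comment> \<open>As \<open>\<bar>v\<bar> \<le> R + M\<close>, this choice makes
    \<open>- lam w\<close> outweigh \<open>2 R + v\<^sup>2\<close>, which is the sign condition for
    the surplus \<open>r\<close>.\<close>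
  define \<Lambda> where "\<Lambda> = (2 * R + (R + M)\<^sup>2 + 1) / m"
  have \<Lambda>: "\<Lambda> > 0" unfolding \<Lambda>_def using m R by (intro divide_pos_pos add_nonneg_pos) auto
  have "pangle a (\<lambda>t. lam * w t - q t) 1 < pi - \<beta>"
    if w: "L1 w" and q: "L1 q" and wm: "\<forall>t\<in>{0..1}. m \<le> w t"
      and qM: "integral {0..1} (\<lambda>t. \<bar>q t\<bar>) \<le> M" and lam: "lam \<le> - \<Lambda>" for w q lam
  proof -
    define p where "p = (\<lambda>t. lam * w t - q t)"
    have p: "L1 p" unfolding p_def by (intro L1_diff L1_cmult w q)
    define v where "v = (\<lambda>x. (2 * R * x - R) + (0 + integral {0..x} q))"
    define \<phi> where "\<phi> = (\<lambda>x. pi/2 - arctan (v x))"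
    \<comment> \<open>\<open>r\<close> is the slope of \<open>\<phi>\<close> minus the right-hand
      side of the angle equation; the \<open>q\<close> from the slope of \<open>v\<close> cancels
      the \<open>q\<close> in \<open>p\<close>.\<close>
    define r where "r = (\<lambda>t. (- (lam * w t) - 2 * R - (v t)\<^sup>2) / (1 + (v t)\<^sup>2))"
    have acv: "ac v (\<lambda>x. 2 * R + q x)"
      unfolding v_def
      by (intro ac_add ac_integral q ac_from_deriv) (auto intro!: derivative_eq_intros)
    have ac\<phi>0: "ac \<phi> (\<lambda>x. - inverse (1 + (v x)\<^sup>2) * (2 * R + q x))"
      unfolding \<phi>_def
    proof (rule ac_chain[OF acv, of "\<lambda>u. pi/2 - arctan u" "\<lambda>u. - inverse (1 + u\<^sup>2)"])
      show "((\<lambda>u. pi/2 - arctan u) has_real_derivative - inverse (1 + u\<^sup>2)) (at u)" for u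
        by (auto intro!: derivative_eq_intros)
      have "1 + u\<^sup>2 \<noteq> 0" for u :: real using zero_le_power2[of u] by linarith
      then show "continuous_on UNIV (\<lambda>u::real. - inverse (1 + u\<^sup>2))" by (intro continuous_intros) auto
    qed
    have ac\<phi>: "ac \<phi> (\<lambda>x. pruefer_rhs (p x) (\<phi> x) + r x)"
    proof (rule ac_cong[OF ac\<phi>0])
      fix x
      have pos: "1 + (v x)\<^sup>2 > 0" by (simp add: add_pos_nonneg)
      have c: "(cos (arctan (v x)))\<^sup>2 = 1 / (1 + (v x)\<^sup>2)"
        using pos by (simp add: cos_arctan power_divide)
      have s: "(sin (arctan (v x)))\<^sup>2 = (v x)\<^sup>2 / (1 + (v x)\<^sup>2)"
        using pos by (simp add: sin_arctan power_divide)
      have "pruefer_rhs (p x) (\<phi> x) = ((v x)\<^sup>2 + p x) / (1 + (v x)\<^sup>2)"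
        unfolding pruefer_rhs_def \<phi>_def sin_diff cos_diff by (simp add: c s add_divide_distrib)
      then have "pruefer_rhs (p x) (\<phi> x) + r x = ((v x)\<^sup>2 + p x + (- (lam * w x) - 2 * R - (v x)\<^sup>2)) / (1 + (v x)\<^sup>2)"
        by (simp only: r_def add_divide_distrib)
      also have "\<dots> = - inverse (1 + (v x)\<^sup>2) * (2 * R + q x)"
        by (simp add: p_def divide_inverse algebra_simps)
      finally show "- inverse (1 + (v x)\<^sup>2) * (2 * R + q x) = pruefer_rhs (p x) (\<phi> x) + r x" by simp
    qed simp
    have Q: "\<bar>integral {0..x} q\<bar> \<le> M" if "x \<in> {0..1}" for x
      using L1_integral_abs_mono[OF q, of 0 x] L1_integral_abs_le[OF q, of 0 x] qM that by auto
    have r0: "r t \<ge> 0" if t: "t \<in> {0..1}" for t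
    proof -
      have "\<bar>2 * R * t - R\<bar> \<le> R"
      proof -
        have "0 \<le> R * t" "R * t \<le> R * 1" using R t by (auto intro!: mult_left_le mult_nonneg_nonneg)
        then show ?thesis by (simp add: abs_le_iff)
      qed
      then have "\<bar>v t\<bar> \<le> R + M" using Q[OF t] by (simp add: v_def)
      then have "(v t)\<^sup>2 \<le> (R + M)\<^sup>2" using abs_le_square_iff[of "v t" "R + M"] by simp
      moreover have "2 * R + (R + M)\<^sup>2 + 1 \<le> - (lam * w t)"
      proof -
        have "2 * R + (R + M)\<^sup>2 + 1 = \<Lambda> * m" using m by (simp add: \<Lambda>_def)
        also have "\<dots> \<le> - lam * w t" using lam wm t \<Lambda> m by (intro mult_mono) auto
        finally show ?thesis by simp
      qed
      ultimately show ?thesis unfolding r_def by (intro divide_nonneg_nonneg) auto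
    qed
    have "pangle a p 1 \<le> \<phi> 1"
    proof (rule pruefer_compare[OF pangle'[OF p] ac\<phi> p])
      have "\<phi> 0 = pi/2 + arctan R" by (simp add: \<phi>_def v_def arctan_minus)
      then show "pangle a p 0 \<le> \<phi> 0" using T[OF R(2)] pangle(2)[OF p] by simp
    qed (use r0 in auto)
    also have "\<phi> 1 \<le> pi/2 - arctan (R - M)"
      using Q[of 1] by (simp add: \<phi>_def v_def arctan_le_iff)
    also have "\<dots> < pi - \<beta>" using T[OF R(3)] by simp
    finally show ?thesis by (simp add: p_def)
  qed
  with \<Lambda> show ?thesis by (rule that)
qed

text \<open>The amplitude has logarithmic derivative
  \<open>(1 - p) sin \<theta> cos \<theta>\<close>, which is \<open>-1/2\<close> times the diagonal
  kernel. With it the angle alone yields a solution of the linear equation.\<close>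

lemma pruefer_solution:
  assumes \<theta>: "ac \<theta> (\<lambda>t. pruefer_rhs (p t) (\<theta> t))" and p: "L1 p"
  defines "\<rho> \<equiv> \<lambda>x. exp (- (1/2) * integral {0..x} (pkernel p \<theta> \<theta>))"
  shows "ac (\<lambda>x. \<rho> x * sin (\<theta> x)) (\<lambda>x. \<rho> x * cos (\<theta> x))"
    and "ac (\<lambda>x. \<rho> x * cos (\<theta> x)) (\<lambda>x. - p x * (\<rho> x * sin (\<theta> x)))"
proof -
  have c\<theta>: "continuous_on {0..1} \<theta>" by (rule ac_continuous[OF \<theta>])
  have E: "ac (\<lambda>x. exp (- (1/2) * (0 + integral {0..x} (pkernel p \<theta> \<theta>))))
           (\<lambda>x. exp (- (1/2) * (0 + integral {0..x} (pkernel p \<theta> \<theta>))) * (- (1/2) * pkernel p \<theta> \<theta> x))"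
    by (rule ac_exp[OF ac_cmult[OF ac_integral[OF L1_pkernel[OF p c\<theta> c\<theta>]]]])
  have k: "pkernel p \<theta> \<theta> x = (p x - 1) * (2 * (sin (\<theta> x) * cos (\<theta> x)))" for x
    unfolding pkernel_def sin_add sinc_def by simp
  have \<rho>: "ac \<rho> (\<lambda>x. \<rho> x * ((1 - p x) * (sin (\<theta> x) * cos (\<theta> x))))"
    by (rule ac_cong[OF E]) (simp_all add: \<rho>_def k, simp_all add: algebra_simps)
  have cs: "(cos u)\<^sup>2 = 1 - (sin u)\<^sup>2" for u :: real by (rule cos_squared_eq)
  show "ac (\<lambda>x. \<rho> x * sin (\<theta> x)) (\<lambda>x. \<rho> x * cos (\<theta> x))"
  proof (rule ac_cong[OF ac_mult[OF \<rho> ac_sin[OF \<theta>]]])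
    fix x
    have "\<rho> x * ((1 - p x) * (sin (\<theta> x) * cos (\<theta> x))) * sin (\<theta> x) + \<rho> x * (cos (\<theta> x) * pruefer_rhs (p x) (\<theta> x))
      = \<rho> x * cos (\<theta> x) * ((1 - p x) * (sin (\<theta> x))\<^sup>2 + pruefer_rhs (p x) (\<theta> x))"
      by (simp add: power2_eq_square algebra_simps)
    also have "(1 - p x) * (sin (\<theta> x))\<^sup>2 + pruefer_rhs (p x) (\<theta> x) = 1"
      by (simp add: pruefer_rhs_def cs algebra_simps)
    finally show "\<rho> x * ((1 - p x) * (sin (\<theta> x) * cos (\<theta> x))) * sin (\<theta> x) + \<rho> x * (cos (\<theta> x) * pruefer_rhs (p x) (\<theta> x))
      = \<rho> x * cos (\<theta> x)" by simp
  qed simp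
  show "ac (\<lambda>x. \<rho> x * cos (\<theta> x)) (\<lambda>x. - p x * (\<rho> x * sin (\<theta> x)))"
  proof (rule ac_cong[OF ac_mult[OF \<rho> ac_cos[OF \<theta>]]])
    fix x
    have "\<rho> x * ((1 - p x) * (sin (\<theta> x) * cos (\<theta> x))) * cos (\<theta> x) + \<rho> x * (- sin (\<theta> x) * pruefer_rhs (p x) (\<theta> x))
      = \<rho> x * sin (\<theta> x) * ((1 - p x) * (cos (\<theta> x))\<^sup>2 - pruefer_rhs (p x) (\<theta> x))"
      by (simp add: power2_eq_square algebra_simps)
    also have "(1 - p x) * (cos (\<theta> x))\<^sup>2 - pruefer_rhs (p x) (\<theta> x) = - p x"
      by (simp add: pruefer_rhs_def cs algebra_simps)
    finally show "\<rho> x * ((1 - p x) * (sin (\<theta> x) * cos (\<theta> x))) * cos (\<theta> x) + \<rho> x * (- sin (\<theta> x) * pruefer_rhs (p x) (\<theta> x))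
      = - p x * (\<rho> x * sin (\<theta> x))" by simp
  qed simp
qed

section \<open>A uniform bound for solutions\<close>

lemma ac_lipschitz:
  assumes "ac f g" "\<And>t. t \<in> {0..1} \<Longrightarrow> \<bar>g t\<bar> \<le> B" "x \<in> {0..1}" "y \<in> {0..1}"
  shows "\<bar>f x - f y\<bar> \<le> B * \<bar>x - y\<bar>"
proof -
  have *: "\<bar>f b - f a\<bar> \<le> B * (b - a)" if "0 \<le> a" "a \<le> b" "b \<le> 1" for a b
  proof -
    have "\<bar>f b - f a\<bar> \<le> integral {a..b} (\<lambda>t. \<bar>g t\<bar>)" by (rule ac_abs_diff_le[OF assms(1) that])
    also have "\<dots> \<le> integral {a..b} (\<lambda>t. B)"
      using that assms(2) by (intro integral_le L1_int L1_abs ac_L1[OF assms(1)]) auto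
    finally show ?thesis using that by (simp add: mult.commute)
  qed
  show ?thesis using *[of x y] *[of y x] assms(3,4) by (cases "x \<le> y") (auto simp: abs_minus_commute)
qed

text \<open>Let \<open>N\<close> be the maximum of \<open>\<bar>y\<bar>\<close>. A mean value point
  has \<open>\<bar>z\<bar> \<le> 2 N\<close>, and the equation lets \<open>z\<close> vary by at most
  \<open>P N\<close>. So \<open>\<bar>y\<bar>\<close> keeps half its maximum on an interval of
  length \<open>1 / (2 (2 + P))\<close>, and integrating \<open>y\<^sup>2\<close> there gives the
  constant.\<close>

lemma sup_bound_by_potential:
  assumes y: "ac y z" and z: "ac z (\<lambda>t. p t * y t)" and p: "L1 p"
    and P: "integral {0..1} (\<lambda>t. \<bar>p t\<bar>) \<le> P" and x: "x \<in> {0..1}"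
  shows "(y x)\<^sup>2 \<le> 8 * (2 + P) * integral {0..1} (\<lambda>t. (y t)\<^sup>2)"
proof -
  have cy: "continuous_on {0..1} y" and cz: "continuous_on {0..1} z"
    using ac_continuous y z by auto
  obtain x0 where x0: "x0 \<in> {0..1}" "\<And>t. t \<in> {0..1} \<Longrightarrow> \<bar>y t\<bar> \<le> \<bar>y x0\<bar>"
    using continuous_attains_sup[OF compact_Icc, of 0 1 "\<lambda>t. \<bar>y t\<bar>"] continuous_on_rabs[OF cy] by auto
  define N where "N = \<bar>y x0\<bar>"
  have N: "N \<ge> 0" "\<And>t. t \<in> {0..1} \<Longrightarrow> \<bar>y t\<bar> \<le> N" using x0 by (auto simp: N_def)
  have P0: "P \<ge> 0" using P integral_nonneg[OF L1_int[OF L1_abs[OF p]], of 0 1] by auto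
  have zdiff: "\<bar>z b - z a\<bar> \<le> P * N" if "0 \<le> a" "a \<le> b" "b \<le> 1" for a b
  proof -
    have "\<bar>z b - z a\<bar> \<le> integral {a..b} (\<lambda>t. \<bar>p t * y t\<bar>)" by (rule ac_abs_diff_le[OF z that])
    also have "\<dots> \<le> integral {0..1} (\<lambda>t. \<bar>p t * y t\<bar>)" by (rule L1_integral_abs_le[OF ac_L1[OF z] that])
    also have "\<dots> \<le> integral {0..1} (\<lambda>t. N * \<bar>p t\<bar>)"
      using N by (intro integral_le L1_int L1_abs L1_cmult p ac_L1[OF z])
        (auto simp: abs_mult mult.commute[of "\<bar>p _\<bar>"] intro!: mult_right_mono)
    also have "\<dots> = N * integral {0..1} (\<lambda>t. \<bar>p t\<bar>)" by simp
    also have "\<dots> \<le> N * P" by (intro mult_left_mono P N)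
    finally show ?thesis by (simp add: mult.commute)
  qed
  have "\<exists>c\<in>{0<..<1}. y 1 - y 0 = z c * (1 - 0)"
    by (rule mvt_simple) (use ac_has_deriv[OF y cz] in \<open>auto simp: has_field_derivative_def\<close>)
  then obtain c where "c \<in> {0<..<1}" "y 1 - y 0 = z c * (1 - 0)" by blast
  then have c: "c \<in> {0..1}" "z c = y 1 - y 0" by auto
  have zb: "\<bar>z t\<bar> \<le> (2 + P) * N" if "t \<in> {0..1}" for t
  proof -
    have "\<bar>z c\<bar> \<le> 2 * N" using c(2) N(2)[of 0] N(2)[of 1] by auto
    moreover have "\<bar>z t - z c\<bar> \<le> P * N" 
      using zdiff[of t c] zdiff[of c t] that c(1) by (cases "t \<le> c") (auto simp: abs_minus_commute)
    ultimately show ?thesis by (simp add: algebra_simps)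
  qed
  \<comment> \<open>Moving by \<open>l\<close> changes \<open>y\<close> by at most
    \<open>N / 2\<close>; as \<open>l \<le> 1/2\<close>, an interval of this length fits into [0,1]
    on one side of \<open>x0\<close>.\<close>
  define l where "l = 1 / (2 * (2 + P))"
  have l: "l > 0" "l \<le> 1/2" "(2 + P) * l = 1/2" using P0 by (auto simp: l_def field_simps)
  obtain a where a: "0 \<le> a" "a + l \<le> 1" "\<And>t. t \<in> {a..a+l} \<Longrightarrow> \<bar>t - x0\<bar> \<le> l"
  proof (cases "x0 \<le> 1/2")
    case True
    then show ?thesis using l x0(1) by (intro that[of x0]) auto
  next
    case False
    then show ?thesis using l x0(1) by (intro that[of "x0 - l"]) auto
  qed
  have low: "(N/2)\<^sup>2 \<le> (y t)\<^sup>2" if t: "t \<in> {a..a+l}" for t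
  proof -
    have "\<bar>y t - y x0\<bar> \<le> (2 + P) * N * \<bar>t - x0\<bar>"
      using t a by (intro ac_lipschitz[OF y] zb x0) auto
    also have "\<dots> \<le> (2 + P) * N * l" using a(3)[OF t] P0 N by (intro mult_left_mono) auto
    also have "\<dots> = N * ((2 + P) * l)" by simp
    also have "\<dots> = N / 2" by (simp add: l)
    finally have "N/2 \<le> \<bar>y t\<bar>" unfolding N_def by linarith
    then have "\<bar>N/2\<bar> \<le> \<bar>y t\<bar>" using N(1) by simp
    then show ?thesis by (simp only: abs_le_square_iff)
  qed
  have Ly: "L1 (\<lambda>t. (y t)\<^sup>2)" by (intro L1_continuous continuous_intros cy)
  have "l * (N/2)\<^sup>2 = integral {a..a+l} (\<lambda>t. (N/2)\<^sup>2)" using l by simp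
  also have "\<dots> \<le> integral {a..a+l} (\<lambda>t. (y t)\<^sup>2)"
    using low a l by (intro integral_le L1_int Ly) auto
  also have "\<dots> \<le> integral {0..1} (\<lambda>t. (y t)\<^sup>2)"
    using a l by (intro integral_subset_le L1_int Ly) auto
  finally have "N\<^sup>2 * l \<le> 4 * integral {0..1} (\<lambda>t. (y t)\<^sup>2)" by (simp add: power_divide field_simps)
  then have "2 * (2 + P) * (N\<^sup>2 * l) \<le> 2 * (2 + P) * (4 * integral {0..1} (\<lambda>t. (y t)\<^sup>2))"
    using P0 by (intro mult_left_mono) auto
  moreover have "2 * (2 + P) * (N\<^sup>2 * l) = N\<^sup>2"
  proof -
    have "2 * (2 + P) * (N\<^sup>2 * l) = 2 * N\<^sup>2 * ((2 + P) * l)" by (simp only: mult_ac)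
    then show ?thesis by (simp add: l(3))
  qed
  moreover have "(y x)\<^sup>2 \<le> N\<^sup>2" using N(2)[OF x] N(1) by (simp add: abs_le_square_iff[symmetric])
  ultimately have "(y x)\<^sup>2 \<le> 2 * (2 + P) * (4 * integral {0..1} (\<lambda>t. (y t)\<^sup>2))" by linarith
  then show ?thesis by (simp only: mult.assoc mult.left_commute[of 2] mult.left_commute[of "2+P" 4])
qed

section \<open>Energy estimates for a monotone weight\<close>

text \<open>With the weight frozen at an endpoint, \<open>z\<^sup>2 + lam w e y\<^sup>2\<close> has
  derivative \<open>2 q y z + 2 lam (w e - w t) y z\<close>. The second term contributes variation
  times length, an error that vanishes under refinement. Both endpoints are allowed because
  increasing and decreasing coefficients are frozen at opposite ends.\<close>

lemma energy_increment:
  assumes y: "ac y z" and z: "ac z (\<lambda>t. (q t - lam * w t) * y t)" and q: "L1 q" and w: "L1 w"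
    and var: "\<And>a b. 0 \<le> a \<Longrightarrow> a \<le> b \<Longrightarrow> b \<le> 1 \<Longrightarrow> \<bar>w b - w a\<bar> = \<mu> b - \<mu> a"
    and K: "\<And>t. t \<in> {0..1} \<Longrightarrow> \<bar>y t * z t\<bar> \<le> K" and lam: "0 \<le> lam"
    and ab: "0 \<le> a" "a \<le> b" "b \<le> 1" and e: "e = a \<or> e = b"
  shows "\<bar>((z b)\<^sup>2 - (z a)\<^sup>2) + lam * w e * ((y b)\<^sup>2 - (y a)\<^sup>2)\<bar>
           \<le> integral {a..b} (\<lambda>t. \<bar>2 * (q t * (y t * z t))\<bar>) + 2 * lam * K * (\<mu> b - \<mu> a) * (b - a)"
proof -
  have cy: "continuous_on {0..1} y" and cz: "continuous_on {0..1} z"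
    using ac_continuous y z by auto
  have Lq: "L1 (\<lambda>t. 2 * (q t * (y t * z t)))"
    by (intro L1_cmult L1_mult_continuous(2)[OF q] continuous_intros cy cz)
  have zz: "ac (\<lambda>t. z t * z t) (\<lambda>t. (q t - lam * w t) * y t * z t + z t * ((q t - lam * w t) * y t))"
    by (rule ac_mult[OF z z])
  have yy: "ac (\<lambda>t. lam * w e * (y t * y t)) (\<lambda>t. lam * w e * (z t * y t + y t * z t))"
    by (rule ac_cmult[OF ac_mult[OF y y]])
  have sum: "ac (\<lambda>t. z t * z t + lam * w e * (y t * y t)) (\<lambda>t. 2 * (q t * (y t * z t)) + 2 * lam * (w e - w t) * (y t * z t))"
    by (rule ac_cong[OF ac_add[OF zz yy]]) (simp_all add: algebra_simps)
  have eq: "((z b)\<^sup>2 - (z a)\<^sup>2) + lam * w e * ((y b)\<^sup>2 - (y a)\<^sup>2)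
      = integral {a..b} (\<lambda>t. 2 * (q t * (y t * z t)) + 2 * lam * (w e - w t) * (y t * z t))"
    using ac_diff_integral[OF sum ab] by (simp add: power2_eq_square algebra_simps)
  have "\<bar>((z b)\<^sup>2 - (z a)\<^sup>2) + lam * w e * ((y b)\<^sup>2 - (y a)\<^sup>2)\<bar>
      \<le> integral {a..b} (\<lambda>t. \<bar>2 * (q t * (y t * z t))\<bar> + 2 * lam * K * (\<mu> b - \<mu> a))"
  proof -
    have "norm (integral {a..b} (\<lambda>t. 2 * (q t * (y t * z t)) + 2 * lam * (w e - w t) * (y t * z t)))
       \<le> integral {a..b} (\<lambda>t. \<bar>2 * (q t * (y t * z t))\<bar> + 2 * lam * K * (\<mu> b - \<mu> a))"
    proof (rule integral_norm_bound_integral)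
      fix t assume t: "t \<in> {a..b}"
      have "\<bar>w e - w t\<bar> \<le> \<mu> b - \<mu> a"
      proof -
        have "\<bar>w t - w a\<bar> = \<mu> t - \<mu> a" "\<bar>w b - w t\<bar> = \<mu> b - \<mu> t" by (rule var; use t ab in simp)+
        then show ?thesis using e by (elim disjE; hypsubst; linarith)
      qed
      then have "\<bar>w e - w t\<bar> * \<bar>y t * z t\<bar> \<le> (\<mu> b - \<mu> a) * K"
        using K[of t] t ab by (intro mult_mono) auto
      then have "2 * lam * (\<bar>w e - w t\<bar> * \<bar>y t * z t\<bar>) \<le> 2 * lam * ((\<mu> b - \<mu> a) * K)"
        using lam by (intro mult_left_mono) auto
      moreover have "\<bar>2 * lam * (w e - w t) * (y t * z t)\<bar> = 2 * lam * (\<bar>w e - w t\<bar> * \<bar>y t * z t\<bar>)"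
        using lam by (simp add: abs_mult)
      ultimately have "\<bar>2 * lam * (w e - w t) * (y t * z t)\<bar> \<le> 2 * lam * K * (\<mu> b - \<mu> a)"
        by (simp only: mult_ac)
      then show "norm (2 * (q t * (y t * z t)) + 2 * lam * (w e - w t) * (y t * z t))
          \<le> \<bar>2 * (q t * (y t * z t))\<bar> + 2 * lam * K * (\<mu> b - \<mu> a)"
        unfolding real_norm_def by linarith
    next
      show "(\<lambda>t. 2 * (q t * (y t * z t)) + 2 * lam * (w e - w t) * (y t * z t)) integrable_on {a..b}"
        using ab by (intro L1_int ac_L1[OF sum])
      show "(\<lambda>t. \<bar>2 * (q t * (y t * z t))\<bar> + 2 * lam * K * (\<mu> b - \<mu> a)) integrable_on {a..b}"
        using ab by (intro L1_int L1_add L1_abs Lq L1_continuous continuous_intros)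
    qed
    then show ?thesis unfolding eq real_norm_def .
  qed
  also have "\<dots> = integral {a..b} (\<lambda>t. \<bar>2 * (q t * (y t * z t))\<bar>) + 2 * lam * K * (\<mu> b - \<mu> a) * (b - a)"
    using ab integral_add[OF L1_int[OF L1_abs[OF Lq] ab(1,3)] integrable_const_ivl[of "2 * lam * K * (\<mu> b - \<mu> a)" a b]]
    by simp
  finally show ?thesis .
qed

text \<open>Covers both energies \<open>z\<^sup>2 + lam w y\<^sup>2\<close> and \<open>z\<^sup>2 / w + lam y\<^sup>2\<close>; one of them increases and the
  other one decreases along a monotone weight, up to the contribution of \<open>q\<close>.\<close>
lemma energy_monotone:
  assumes y: "ac y z" and z: "ac z (\<lambda>t. (q t - lam * w t) * y t)" and q: "L1 q" and w: "L1 w"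
    and var: "\<And>a b. 0 \<le> a \<Longrightarrow> a \<le> b \<Longrightarrow> b \<le> 1 \<Longrightarrow> \<bar>w b - w a\<bar> = \<mu> b - \<mu> a"
    and lam: "0 \<le> lam"
    and \<alpha>: "\<And>t. t \<in> {0..1} \<Longrightarrow> 0 \<le> \<alpha> t" "\<And>t. t \<in> {0..1} \<Longrightarrow> \<alpha> t \<le> A"
    and \<gamma>: "\<And>t. t \<in> {0..1} \<Longrightarrow> \<gamma> t = \<alpha> t * (lam * w t)"
    and x: "0 \<le> x1" "x1 \<le> x2" "x2 \<le> 1"
  defines "E \<equiv> \<lambda>x. \<alpha> x * (z x)\<^sup>2 + \<gamma> x * (y x)\<^sup>2"
    and "J \<equiv> integral {0..1} (\<lambda>t. \<bar>2 * (q t * (y t * z t))\<bar>)"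
  shows "mono_on {0..1} \<alpha> \<Longrightarrow> mono_on {0..1} \<gamma> \<Longrightarrow> E x1 \<le> E x2 + A * J"
    and "antimono_on {0..1} \<alpha> \<Longrightarrow> antimono_on {0..1} \<gamma> \<Longrightarrow> E x2 \<le> E x1 + A * J"
proof -
  have cy: "continuous_on {0..1} y" and cz: "continuous_on {0..1} z"
    using ac_continuous y z by auto
  have "compact ((\<lambda>t. y t * z t) ` {0..1})"
    by (intro compact_continuous_image continuous_intros cy cz) auto
  then obtain K where K: "\<And>t. t \<in> {0..1} \<Longrightarrow> \<bar>y t * z t\<bar> \<le> K"
    using compact_imp_bounded[of "(\<lambda>t. y t * z t) ` {0..1}"] unfolding bounded_iff by fastforce
  have K0: "K \<ge> 0" using K[of 0] by (meson abs_ge_zero atLeastAtMost_iff order.refl order_trans zero_le_one)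
  have A0: "A \<ge> 0" using \<alpha>[of 0] by auto
  have Lq: "L1 (\<lambda>t. \<bar>2 * (q t * (y t * z t))\<bar>)"
    by (intro L1_abs L1_cmult L1_mult_continuous(2)[OF q] continuous_intros cy cz)
  define I where "I = (\<lambda>x. integral {0..x} (\<lambda>t. \<bar>2 * (q t * (y t * z t))\<bar>))"
  have I: "I b - I a = integral {a..b} (\<lambda>t. \<bar>2 * (q t * (y t * z t))\<bar>)" if "0 \<le> a" "a \<le> b" "b \<le> 1" for a b
    using ac_diff_integral[OF ac_integral[OF Lq, of 0] that] by (simp add: I_def)
  have I0: "0 \<le> I b - I a" if "0 \<le> a" "a \<le> b" "b \<le> 1" for a b
    unfolding I[OF that] by (rule integral_nonneg[OF L1_int[OF Lq that(1,3)] abs_ge_zero])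
  have IJ: "I x2 - I x1 \<le> J"
    using I0[of 0 x1] I0[of x2 1] x unfolding J_def I_def by simp
  define L where "L = A * (2 * lam * K)"
  have L: "L \<ge> 0" using A0 K0 lam by (simp add: L_def)
  have err: "\<alpha> e * \<bar>((z b)\<^sup>2 - (z a)\<^sup>2) + lam * w e * ((y b)\<^sup>2 - (y a)\<^sup>2)\<bar>
       \<le> A * (I b - I a) + L * (\<mu> b - \<mu> a) * (b - a)" if ab: "0 \<le> a" "a \<le> b" "b \<le> 1" and e: "e = a \<or> e = b" for a b e
  proof -
    have e01: "e \<in> {0..1}" using ab e by auto
    have mu: "0 \<le> \<mu> b - \<mu> a" using var[OF ab] by (metis abs_ge_zero)
    have "\<alpha> e * \<bar>((z b)\<^sup>2 - (z a)\<^sup>2) + lam * w e * ((y b)\<^sup>2 - (y a)\<^sup>2)\<bar>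
        \<le> A * (I b - I a + 2 * lam * K * (\<mu> b - \<mu> a) * (b - a))"
      unfolding I[OF ab]
      by (intro mult_mono \<alpha> e01 energy_increment[OF y z q w var K lam ab e] A0) auto
    then show ?thesis by (simp add: L_def algebra_simps)
  qed
  \<comment> \<open>The length factor supplies the smallness, and the variation \<open>\<mu>\<close>
    is the additive majorant; \<open>+ 1\<close> covers \<open>L = 0\<close>.\<close>
  have small: "\<exists>\<delta>>0. \<forall>a b. 0 \<le> a \<and> a \<le> b \<and> b \<le> 1 \<and> b - a < \<delta> \<longrightarrow>
      L * (\<mu> b - \<mu> a) * (b - a) \<le> \<epsilon> * (\<mu> b - \<mu> a)" if "\<epsilon> > 0" for \<epsilon>
  proof (intro exI[of _ "\<epsilon> / (L + 1)"] conjI allI impI)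
    show "0 < \<epsilon> / (L + 1)" using that L by simp
    fix a b assume *: "0 \<le> a \<and> a \<le> b \<and> b \<le> 1 \<and> b - a < \<epsilon> / (L + 1)"
    then have mu: "0 \<le> \<mu> b - \<mu> a" using var[of a b] by (metis abs_ge_zero)
    have "(L + 1) * (b - a) \<le> \<epsilon>" using * L by (simp add: field_simps)
    then have "L * (b - a) \<le> \<epsilon>" using * by (simp add: algebra_simps)
    then have "L * (b - a) * (\<mu> b - \<mu> a) \<le> \<epsilon> * (\<mu> b - \<mu> a)" using mu by (rule mult_right_mono)
    then show "L * (\<mu> b - \<mu> a) * (b - a) \<le> \<epsilon> * (\<mu> b - \<mu> a)" by (simp only: mult_ac)
  qed
  show "E x1 \<le> E x2 + A * J" if mono: "mono_on {0..1} \<alpha>" "mono_on {0..1} \<gamma>"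
  proof -
    \<comment> \<open>The primitive \<open>I\<close> with factor \<open>A\<close> pays for all that
      \<open>q\<close> contributes, so only the refinable error remains.\<close>
    have "E x1 + A * I x1 \<le> E x2 + A * I x2"
    proof (rule nondecreasing_if_locally_up_to_eps[where \<Phi> = "\<lambda>x. E x + A * I x" and \<mu> = \<mu>, OF _ x])
      fix \<epsilon> :: real assume "\<epsilon> > 0"
      then obtain \<delta> where \<delta>: "\<delta> > 0" "\<And>a b. 0 \<le> a \<and> a \<le> b \<and> b \<le> 1 \<and> b - a < \<delta> \<Longrightarrow>
          L * (\<mu> b - \<mu> a) * (b - a) \<le> \<epsilon> * (\<mu> b - \<mu> a)" using small by meson
      have "E a + A * I a \<le> E b + A * I b + \<epsilon> * (\<mu> b - \<mu> a)"
        if *: "0 \<le> a \<and> a \<le> b \<and> b \<le> 1 \<and> b - a < \<delta>" for a b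
      proof -
        have ab: "0 \<le> a" "a \<le> b" "b \<le> 1" using * by auto
        then have b: "b \<in> {0..1}" and "\<alpha> a \<le> \<alpha> b" "\<gamma> a \<le> \<gamma> b" using mono by (auto simp: mono_on_def)
        then have "\<alpha> a * (z a)\<^sup>2 \<le> \<alpha> b * (z a)\<^sup>2" "\<gamma> a * (y a)\<^sup>2 \<le> \<gamma> b * (y a)\<^sup>2"
          by (auto intro: mult_right_mono)
        \<comment> \<open>Raising both coefficients to their values at \<open>b\<close> only
          increases the energy at \<open>a\<close>; what remains is the increment with the weight
          frozen at \<open>b\<close>.\<close>
        then have "E a \<le> E b - \<alpha> b * (((z b)\<^sup>2 - (z a)\<^sup>2) + lam * w b * ((y b)\<^sup>2 - (y a)\<^sup>2))"
          unfolding E_def \<gamma>[OF b] by (simp add: algebra_simps)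
        moreover have "- (\<alpha> b * (((z b)\<^sup>2 - (z a)\<^sup>2) + lam * w b * ((y b)\<^sup>2 - (y a)\<^sup>2)))
            \<le> \<alpha> b * \<bar>((z b)\<^sup>2 - (z a)\<^sup>2) + lam * w b * ((y b)\<^sup>2 - (y a)\<^sup>2)\<bar>"
          unfolding mult_minus_right[symmetric] by (intro mult_left_mono \<alpha> b) auto
        ultimately show ?thesis using err[OF ab, of b] \<delta>(2)[OF *] by (simp add: right_diff_distrib)
      qed
      then show "\<exists>\<delta>>0. \<forall>a b. 0 \<le> a \<and> a \<le> b \<and> b \<le> 1 \<and> b - a < \<delta> \<longrightarrow>
        E a + A * I a \<le> E b + A * I b + \<epsilon> * (\<mu> b - \<mu> a)" using \<delta>(1) by blast
    qed
    moreover have "A * (I x2 - I x1) \<le> A * J" by (intro mult_left_mono IJ A0)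
    ultimately show ?thesis by (simp add: right_diff_distrib)
  qed
  show "E x2 \<le> E x1 + A * J" if mono: "antimono_on {0..1} \<alpha>" "antimono_on {0..1} \<gamma>"
  proof -
    have "- E x1 + A * I x1 \<le> - E x2 + A * I x2"
    proof (rule nondecreasing_if_locally_up_to_eps[where \<Phi> = "\<lambda>x. - E x + A * I x" and \<mu> = \<mu>, OF _ x])
      fix \<epsilon> :: real assume "\<epsilon> > 0"
      then obtain \<delta> where \<delta>: "\<delta> > 0" "\<And>a b. 0 \<le> a \<and> a \<le> b \<and> b \<le> 1 \<and> b - a < \<delta> \<Longrightarrow>
          L * (\<mu> b - \<mu> a) * (b - a) \<le> \<epsilon> * (\<mu> b - \<mu> a)" using small by meson
      have "- E a + A * I a \<le> - E b + A * I b + \<epsilon> * (\<mu> b - \<mu> a)"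
        if *: "0 \<le> a \<and> a \<le> b \<and> b \<le> 1 \<and> b - a < \<delta>" for a b
      proof -
        have ab: "0 \<le> a" "a \<le> b" "b \<le> 1" using * by auto
        then have a: "a \<in> {0..1}" and "\<alpha> b \<le> \<alpha> a" "\<gamma> b \<le> \<gamma> a" using mono by (auto simp: monotone_on_def)
        then have "\<alpha> b * (z b)\<^sup>2 \<le> \<alpha> a * (z b)\<^sup>2" "\<gamma> b * (y b)\<^sup>2 \<le> \<gamma> a * (y b)\<^sup>2"
          by (auto intro: mult_right_mono)
        \<comment> \<open>The coefficients now decrease, so the left endpoint carries the larger
          values and the weight is frozen there.\<close>
        then have "E b \<le> E a + \<alpha> a * (((z b)\<^sup>2 - (z a)\<^sup>2) + lam * w a * ((y b)\<^sup>2 - (y a)\<^sup>2))"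
          unfolding E_def \<gamma>[OF a] by (simp add: algebra_simps)
        moreover have "\<alpha> a * (((z b)\<^sup>2 - (z a)\<^sup>2) + lam * w a * ((y b)\<^sup>2 - (y a)\<^sup>2))
            \<le> \<alpha> a * \<bar>((z b)\<^sup>2 - (z a)\<^sup>2) + lam * w a * ((y b)\<^sup>2 - (y a)\<^sup>2)\<bar>"
          by (intro mult_left_mono \<alpha> a) auto
        ultimately show ?thesis using err[OF ab, of a] \<delta>(2)[OF *] by (simp add: right_diff_distrib)
      qed
      then show "\<exists>\<delta>>0. \<forall>a b. 0 \<le> a \<and> a \<le> b \<and> b \<le> 1 \<and> b - a < \<delta> \<longrightarrow>
        - E a + A * I a \<le> - E b + A * I b + \<epsilon> * (\<mu> b - \<mu> a)" using \<delta>(1) by blast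
    qed
    moreover have "A * (I x2 - I x1) \<le> A * J" by (intro mult_left_mono IJ A0)
    ultimately show ?thesis by (simp add: right_diff_distrib)
  qed
qed

text \<open>For increasing \<open>w\<close>, up to \<open>q\<close>, the energy \<open>H\<close>
  increases while \<open>H / w\<close> decreases; for decreasing \<open>w\<close> the roles are
  exchanged. Whatever the order of \<open>x1\<close> and \<open>x2\<close>, one of the two controls
  \<open>H x1\<close>, and returning from \<open>H / w\<close> to \<open>H\<close> costs the factor
  \<open>W / m\<close>.\<close>

lemma energy_comparable:
  assumes y: "ac y z" and z: "ac z (\<lambda>t. (q t - lam * w t) * y t)" and q: "L1 q" and w: "L1 w"
    and mon: "mono_on {0..1} w \<or> antimono_on {0..1} w"
    and m: "m > 0" "\<And>t. t \<in> {0..1} \<Longrightarrow> m \<le> w t" and W: "\<And>t. t \<in> {0..1} \<Longrightarrow> w t \<le> W"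
    and lam: "0 \<le> lam" and x: "x1 \<in> {0..1}" "x2 \<in> {0..1}"
  defines "H \<equiv> \<lambda>x. (z x)\<^sup>2 + lam * w x * (y x)\<^sup>2"
    and "J \<equiv> integral {0..1} (\<lambda>t. \<bar>2 * (q t * (y t * z t))\<bar>)"
  shows "H x1 \<le> W / m * (H x2 + J)"
proof -
  \<comment> \<open>A monotone weight is, up to sign, its own variation function.\<close>
  define \<mu> where "\<mu> = (if mono_on {0..1} w then w else (\<lambda>t. - w t))"
  have var: "\<bar>w b - w a\<bar> = \<mu> b - \<mu> a" if "0 \<le> a" "a \<le> b" "b \<le> 1" for a b
    using mon that by (auto simp: \<mu>_def monotone_on_def)
  have wpos: "w t > 0" if "t \<in> {0..1}" for t using m(1) m(2)[OF that] by linarith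
  have Hpos: "0 \<le> H t" if "t \<in> {0..1}" for t
    unfolding H_def using wpos[OF that] lam by simp
  have J0: "0 \<le> J" unfolding J_def by (intro integral_nonneg L1_int L1_abs L1_cmult L1_mult_continuous(2)[OF q]
        continuous_intros ac_continuous[OF y] ac_continuous[OF z]) auto
  have \<kappa>: "1 \<le> W / m" using m(1) m(2)[of 0] W[of 0] by (simp add: field_simps)
  have H: "mono_on {0..1} w \<Longrightarrow> H s \<le> H t + J" "antimono_on {0..1} w \<Longrightarrow> H t \<le> H s + J"
    if st: "0 \<le> s" "s \<le> t" "t \<le> 1" for s t
  proof -
    show "H s \<le> H t + J" if "mono_on {0..1} w"
    proof -
      have "1 * (z s)\<^sup>2 + lam * w s * (y s)\<^sup>2 \<le> 1 * (z t)\<^sup>2 + lam * w t * (y t)\<^sup>2 + 1 * J"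
        unfolding J_def
        by (rule energy_monotone(1)[OF y z q w var lam, where \<alpha> = "\<lambda>x. 1" and A = 1 and \<gamma> = "\<lambda>x. lam * w x"])
          (use st that lam in \<open>auto simp: monotone_on_def intro: mult_left_mono\<close>)
      then show ?thesis by (simp add: H_def)
    qed
    show "H t \<le> H s + J" if "antimono_on {0..1} w"
    proof -
      have "1 * (z t)\<^sup>2 + lam * w t * (y t)\<^sup>2 \<le> 1 * (z s)\<^sup>2 + lam * w s * (y s)\<^sup>2 + 1 * J"
        unfolding J_def
        by (rule energy_monotone(2)[OF y z q w var lam, where \<alpha> = "\<lambda>x. 1" and A = 1 and \<gamma> = "\<lambda>x. lam * w x"])
          (use st that lam in \<open>auto simp: monotone_on_def intro: mult_left_mono\<close>)
      then show ?thesis by (simp add: H_def)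
    qed
  qed
  have G: "H t / w t = inverse (w t) * (z t)\<^sup>2 + lam * (y t)\<^sup>2" if "t \<in> {0..1}" for t
    using wpos[OF that] by (simp add: H_def field_simps)
  have inv: "inverse (w t) \<le> 1 / m" "0 \<le> inverse (w t)" "lam = inverse (w t) * (lam * w t)" if "t \<in> {0..1}" for t
    using wpos[OF that] m(1) m(2)[OF that] le_imp_inverse_le[of m "w t"] by (simp_all add: inverse_eq_divide)
  have G1: "H s / w s \<le> H t / w t + 1 / m * J" if a: "antimono_on {0..1} w" and st: "0 \<le> s" "s \<le> t" "t \<le> 1" for s t
  proof -
    have "mono_on {0..1} (\<lambda>t. inverse (w t))"
      using a by (intro monotone_onI le_imp_inverse_le wpos) (simp_all add: monotone_on_def)
    have "inverse (w s) * (z s)\<^sup>2 + lam * (y s)\<^sup>2 \<le> inverse (w t) * (z t)\<^sup>2 + lam * (y t)\<^sup>2 + 1 / m * J"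
      unfolding J_def
    proof (rule energy_monotone(1)[OF y z q w var lam, where \<alpha> = "\<lambda>x. inverse (w x)" and A = "1 / m" and \<gamma> = "\<lambda>x. lam"])
      show "0 \<le> inverse (w t)" "inverse (w t) \<le> 1 / m" "lam = inverse (w t) * (lam * w t)" if "t \<in> {0..1}" for t
        using inv[OF that] by blast+
    qed (assumption | rule st \<open>mono_on {0..1} (\<lambda>t. inverse (w t))\<close> | simp add: monotone_on_def)+
    then show ?thesis using st by (simp add: G)
  qed
  have G2: "H t / w t \<le> H s / w s + 1 / m * J" if a: "mono_on {0..1} w" and st: "0 \<le> s" "s \<le> t" "t \<le> 1" for s t
  proof -
    have "antimono_on {0..1} (\<lambda>t. inverse (w t))"
      using a by (intro monotone_onI le_imp_inverse_le wpos) (simp_all add: monotone_on_def)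
    have "inverse (w t) * (z t)\<^sup>2 + lam * (y t)\<^sup>2 \<le> inverse (w s) * (z s)\<^sup>2 + lam * (y s)\<^sup>2 + 1 / m * J"
      unfolding J_def
    proof (rule energy_monotone(2)[OF y z q w var lam, where \<alpha> = "\<lambda>x. inverse (w x)" and A = "1 / m" and \<gamma> = "\<lambda>x. lam"])
      show "0 \<le> inverse (w t)" "inverse (w t) \<le> 1 / m" "lam = inverse (w t) * (lam * w t)" if "t \<in> {0..1}" for t
        using inv[OF that] by blast+
    qed (assumption | rule st \<open>antimono_on {0..1} (\<lambda>t. inverse (w t))\<close> | simp add: monotone_on_def)+
    then show ?thesis using st by (simp add: G)
  qed
  have direct: ?thesis if "H x1 \<le> H x2 + J"
  proof -
    have "1 * (H x2 + J) \<le> W / m * (H x2 + J)"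
      using \<kappa> Hpos[OF x(2)] J0 by (intro mult_right_mono) auto
    then show ?thesis using that by simp
  qed
  have weighted: ?thesis if "H x1 / w x1 \<le> H x2 / w x2 + 1 / m * J"
  proof -
    have "H x2 / w x2 \<le> H x2 / m" using m(1) m(2)[OF x(2)] Hpos[OF x(2)] by (intro divide_left_mono) (auto simp: wpos x)
    then have *: "H x1 / w x1 \<le> (H x2 + J) / m" using that by (simp add: add_divide_distrib)
    have "H x1 = w x1 * (H x1 / w x1)" using wpos[OF x(1)] by simp
    also have "\<dots> \<le> W * ((H x2 + J) / m)"
      using * W[OF x(1)] wpos[OF x(1)] Hpos[OF x(1)] by (intro mult_mono) auto
    finally show ?thesis by simp
  qed
  show ?thesis
  proof (cases "x1 \<le> x2")
    case True
    then have "0 \<le> x1" "x1 \<le> x2" "x2 \<le> 1" using x by auto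
    then show ?thesis using mon H(1)[of x1 x2] G1[of x1 x2] direct weighted by blast
  next
    case False
    then have "0 \<le> x2" "x2 \<le> x1" "x1 \<le> 1" using x by auto
    then show ?thesis using mon H(2)[of x2 x1] G2[of x2 x1] direct weighted by blast
  qed
qed

text \<open>Comparability bounds the supremum \<open>S\<close> of the energy by a multiple of its
  mean. The identity for the derivative of \<open>y z\<close> equates this mean with
  \<open>2 lam \<integral> w y\<^sup>2\<close> up to boundary and potential terms of order
  \<open>S / \<sigma>\<close>, which large \<open>lam\<close> absorbs. As
  \<open>lam m y\<^sup>2 \<le> S\<close>, the factor \<open>lam\<close> cancels.\<close>

lemma sup_bound_large_eigenparameter:
  assumes y: "ac y z" and z: "ac z (\<lambda>t. (q t - lam * w t) * y t)" and q: "L1 q" and w: "L1 w"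
    and mon: "mono_on {0..1} w \<or> antimono_on {0..1} w"
    and m: "m > 0" "\<And>t. t \<in> {0..1} \<Longrightarrow> m \<le> w t" and W: "\<And>t. t \<in> {0..1} \<Longrightarrow> w t \<le> W"
    and M: "integral {0..1} (\<lambda>t. \<bar>q t\<bar>) \<le> M"
    and lam: "(4 * (W / m) * (1 + M))\<^sup>2 / m \<le> lam" and x: "x \<in> {0..1}"
  shows "(y x)\<^sup>2 \<le> 8 * (W / m) / m * integral {0..1} (\<lambda>t. w t * (y t)\<^sup>2)"
proof -
  have cy: "continuous_on {0..1} y" and cz: "continuous_on {0..1} z"
    using ac_continuous y z by auto
  have M0: "M \<ge> 0" using M integral_nonneg[OF L1_int[OF L1_abs[OF q]], of 0 1] by auto
  define \<kappa> where "\<kappa> = W / m"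
  have \<kappa>: "1 \<le> \<kappa>" using m(1) m(2)[of 0] W[of 0] by (simp add: \<kappa>_def field_simps)
  have lam0: "0 \<le> lam" using lam m(1) by (meson divide_nonneg_pos order_trans zero_le_power2)
  \<comment> \<open>The energy dominates \<open>\<sigma>\<^sup>2 y\<^sup>2 + z\<^sup>2\<close>, so
    products \<open>y z\<close> gain a factor \<open>1 / \<sigma>\<close>. The threshold for
    \<open>lam\<close> is chosen to give \<open>4 \<kappa> (1 + M) \<le> \<sigma>\<close>.\<close>
  define \<sigma> where "\<sigma> = sqrt (lam * m)"
  have \<sigma>2: "\<sigma>\<^sup>2 = lam * m" using lam0 m(1) by (simp add: \<sigma>_def)
  have "(4 * \<kappa> * (1 + M))\<^sup>2 \<le> lam * m" using lam m(1) by (simp add: \<kappa>_def pos_divide_le_eq)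
  then have \<sigma>: "4 * \<kappa> * (1 + M) \<le> \<sigma>" unfolding \<sigma>_def by (rule real_le_rsqrt)
  have "4 * 1 * (1 + 0) \<le> 4 * \<kappa> * (1 + M)" using \<kappa> M0 by (intro mult_mono) auto
  then have \<sigma>4: "4 \<le> \<sigma>" using \<sigma> by simp
  then have lampos: "lam > 0" using \<sigma>2 m(1) lam0 by (cases "lam = 0") auto
  define H where "H = (\<lambda>x. (z x)\<^sup>2 + lam * w x * (y x)\<^sup>2)"
  \<comment> \<open>\<open>H\<close> may jump together with \<open>w\<close>, so a supremum takes
    the place of a maximum.\<close>
  define S where "S = (SUP x\<in>{0..1}. H x)"
  have lower: "\<sigma>\<^sup>2 * (y t)\<^sup>2 + (z t)\<^sup>2 \<le> H t" if "t \<in> {0..1}" for t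
  proof -
    have "lam * m * (y t)\<^sup>2 \<le> lam * w t * (y t)\<^sup>2"
      using m(2)[OF that] lam0 by (intro mult_right_mono mult_left_mono) auto
    then show ?thesis by (simp add: H_def \<sigma>2)
  qed
  have bdd: "bdd_above (H ` {0..1})"
  proof -
    have "continuous_on {0..1} (\<lambda>x. (z x)\<^sup>2 + lam * W * (y x)\<^sup>2)" by (intro continuous_intros cy cz)
    then have "bdd_above ((\<lambda>x. (z x)\<^sup>2 + lam * W * (y x)\<^sup>2) ` {0..1})"
      by (intro bounded_imp_bdd_above compact_imp_bounded compact_continuous_image) auto
    then obtain U where U: "\<And>t. t \<in> {0..1} \<Longrightarrow> (z t)\<^sup>2 + lam * W * (y t)\<^sup>2 \<le> U"
      unfolding bdd_above_def by blast
    have "H t \<le> U" if "t \<in> {0..1}" for t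
    proof -
      have "lam * w t * (y t)\<^sup>2 \<le> lam * W * (y t)\<^sup>2"
        using W[OF that] lam0 by (intro mult_right_mono mult_left_mono) auto
      then show ?thesis using U[OF that] by (simp add: H_def)
    qed
    then show ?thesis by (intro bdd_aboveI2)
  qed
  have HS: "H t \<le> S" if "t \<in> {0..1}" for t
    unfolding S_def by (rule cSUP_upper[OF that bdd])
  have y2: "\<sigma>\<^sup>2 * (y t)\<^sup>2 \<le> S" and yz: "2 * \<bar>y t * z t\<bar> \<le> S / \<sigma>" if t: "t \<in> {0..1}" for t
  proof -
    have 1: "\<sigma>\<^sup>2 * (y t)\<^sup>2 + (z t)\<^sup>2 \<le> S" using lower[OF t] HS[OF t] by linarith
    then show "\<sigma>\<^sup>2 * (y t)\<^sup>2 \<le> S" using zero_le_power2[of "z t"] by linarith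
    have "0 \<le> (\<sigma> * \<bar>y t\<bar> - \<bar>z t\<bar>)\<^sup>2" by simp
    then have "2 * \<bar>y t * z t\<bar> * \<sigma> \<le> \<sigma>\<^sup>2 * (y t)\<^sup>2 + (z t)\<^sup>2"
      by (simp add: power2_diff power_mult_distrib abs_mult algebra_simps)
    then have "2 * \<bar>y t * z t\<bar> * \<sigma> \<le> S" using 1 by linarith
    then show "2 * \<bar>y t * z t\<bar> \<le> S / \<sigma>" using \<sigma>4 by (subst pos_le_divide_eq) auto
  qed
  have S0: "0 \<le> S" using y2[of 0] by (meson atLeastAtMost_iff order.refl order_trans zero_le_mult_iff zero_le_one zero_le_power2)
  have q_le: "integral {0..1} (\<lambda>t. \<bar>q t * g t\<bar>) \<le> M * c"
    if "\<And>t. t \<in> {0..1} \<Longrightarrow> \<bar>g t\<bar> \<le> c" "continuous_on {0..1} g" "c \<ge> 0" for g c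
  proof -
    have "integral {0..1} (\<lambda>t. \<bar>q t * g t\<bar>) \<le> integral {0..1} (\<lambda>t. c * \<bar>q t\<bar>)"
      using that by (intro integral_le L1_int L1_cmult L1_abs q L1_mult_continuous(2))
        (auto simp: abs_mult mult.commute[of "\<bar>q _\<bar>"] intro!: mult_right_mono)
    also have "\<dots> = c * integral {0..1} (\<lambda>t. \<bar>q t\<bar>)" by simp
    also have "\<dots> \<le> c * M" using that M by (intro mult_left_mono)
    finally show ?thesis by (simp add: mult.commute)
  qed
  define J where "J = integral {0..1} (\<lambda>t. \<bar>2 * (q t * (y t * z t))\<bar>)"
  have "J = integral {0..1} (\<lambda>t. \<bar>q t * (2 * (y t * z t))\<bar>)" by (simp add: J_def mult.left_commute)
  also have "\<dots> \<le> M * (S / \<sigma>)"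
    using yz S0 \<sigma>4 by (intro q_le) (auto simp: abs_mult intro!: continuous_intros cy cz)
  finally have J: "J \<le> M * (S / \<sigma>)" .
  have frac: "\<kappa> * (1 + M) * (S / \<sigma>) \<le> S / 4"
  proof -
    have "(4 * \<kappa> * (1 + M)) * S \<le> \<sigma> * S" by (intro mult_right_mono \<sigma> S0)
    then show ?thesis using \<sigma>4 by (simp add: field_simps)
  qed
  have kM: "\<kappa> * (M * (S / \<sigma>)) \<le> \<kappa> * (1 + M) * (S / \<sigma>)"
  proof -
    have "0 \<le> \<kappa> * (S / \<sigma>)" using \<kappa> S0 \<sigma>4 by simp
    then show ?thesis by (simp add: algebra_simps)
  qed
  \<comment> \<open>The \<open>q\<close> term is at most \<open>S / 4\<close>, which leaves
    \<open>3/4 S \<le> \<kappa> H t\<close>; the factor is rounded up to 2.\<close>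
  have SH: "S \<le> 2 * \<kappa> * H t" if t: "t \<in> {0..1}" for t
  proof -
    have "S \<le> \<kappa> * (H t + J)"
      unfolding S_def
    proof (rule cSUP_least)
      fix s :: real assume "s \<in> {0..1}"
      then show "H s \<le> \<kappa> * (H t + J)"
        unfolding H_def J_def \<kappa>_def by (intro energy_comparable[OF y z q w mon m W lam0 _ t])
    qed simp
    moreover have "\<kappa> * J \<le> \<kappa> * (M * (S / \<sigma>))" using \<kappa> J by (intro mult_left_mono) auto
    ultimately have "S \<le> \<kappa> * H t + S / 4" using kM frac by (simp only: distrib_left)
    then show ?thesis using S0 by linarith
  qed
  define I where "I = integral {0..1} (\<lambda>t. w t * (y t)\<^sup>2)"
  have Lz: "L1 (\<lambda>t. (z t)\<^sup>2)" by (intro L1_continuous continuous_intros cz)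
  have Lw: "L1 (\<lambda>t. w t * (y t)\<^sup>2)" by (intro L1_mult_continuous(2) w continuous_intros cy)
  have Lqy: "L1 (\<lambda>t. q t * (y t)\<^sup>2)" by (intro L1_mult_continuous(2) q continuous_intros cy)
  have LH: "L1 H" unfolding H_def mult.assoc by (intro L1_add Lz L1_cmult Lw)
  \<comment> \<open>The derivative of \<open>y z\<close> is
    \<open>z\<^sup>2 - lam w y\<^sup>2\<close> plus the potential term; this trades the integral of
    the energy for that of \<open>w y\<^sup>2\<close>.\<close>
  have "ac (\<lambda>t. y t * z t) (\<lambda>t. H t + (q t * (y t)\<^sup>2 - 2 * lam * (w t * (y t)\<^sup>2)))"
    by (rule ac_cong[OF ac_mult[OF y z]]) (simp_all add: H_def power2_eq_square algebra_simps)
  from ac_diff_integral[OF this, of 0 1]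
  have "y 1 * z 1 - y 0 * z 0 = integral {0..1} (\<lambda>t. H t + (q t * (y t)\<^sup>2 - 2 * lam * (w t * (y t)\<^sup>2)))" by simp
  also have "\<dots> = integral {0..1} H + integral {0..1} (\<lambda>t. q t * (y t)\<^sup>2 - 2 * lam * (w t * (y t)\<^sup>2))"
    by (rule integral_add) (intro L1_int LH L1_diff Lqy L1_cmult Lw order.refl)+
  also have "integral {0..1} (\<lambda>t. q t * (y t)\<^sup>2 - 2 * lam * (w t * (y t)\<^sup>2))
      = integral {0..1} (\<lambda>t. q t * (y t)\<^sup>2) - integral {0..1} (\<lambda>t. 2 * lam * (w t * (y t)\<^sup>2))"
    by (rule integral_diff) (intro L1_int Lqy L1_cmult Lw order.refl)+
  also have "integral {0..1} (\<lambda>t. 2 * lam * (w t * (y t)\<^sup>2)) = 2 * lam * I" by (simp add: I_def)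
  finally have IH: "integral {0..1} H = 2 * lam * I + (y 1 * z 1 - y 0 * z 0) - integral {0..1} (\<lambda>t. q t * (y t)\<^sup>2)"
    by linarith
  have bdry: "y 1 * z 1 - y 0 * z 0 \<le> S / \<sigma>"
    using yz[of 0] yz[of 1] abs_ge_self[of "y 1 * z 1"] abs_ge_minus_self[of "y 0 * z 0"] by simp
  have "\<bar>integral {0..1} (\<lambda>t. q t * (y t)\<^sup>2)\<bar> \<le> integral {0..1} (\<lambda>t. \<bar>q t * (y t)\<^sup>2\<bar>)"
    by (intro L1_integral_abs_mono Lqy) auto
  also have "\<dots> \<le> M * (S / \<sigma>)"
  proof (rule q_le)
    fix t :: real assume t: "t \<in> {0..1}"
    \<comment> \<open>\<open>\<sigma> \<ge> 1\<close> weakens \<open>S / \<sigma>\<^sup>2\<close> to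
      \<open>S / \<sigma>\<close>, so that boundary and potential terms combine into
      \<open>(1 + M) S / \<sigma>\<close>.\<close>
    have "\<sigma> * 1 * (y t)\<^sup>2 \<le> \<sigma> * \<sigma> * (y t)\<^sup>2" using \<sigma>4 by (intro mult_right_mono mult_left_mono) auto
    then have "(y t)\<^sup>2 * \<sigma> \<le> S" using y2[OF t] by (simp add: power2_eq_square mult_ac)
    then show "\<bar>(y t)\<^sup>2\<bar> \<le> S / \<sigma>" using \<sigma>4 by (subst pos_le_divide_eq) auto
  qed (use S0 \<sigma>4 in \<open>auto intro!: continuous_intros cy\<close>)
  finally have IqH: "integral {0..1} H \<le> 2 * lam * I + (1 + M) * (S / \<sigma>)"
    unfolding IH distrib_right mult_1 using bdry by linarith
  have "S = integral {0..1} (\<lambda>t::real. S)" by simp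
  also have "\<dots> \<le> integral {0..1} (\<lambda>t. 2 * \<kappa> * H t)"
    by (intro integral_le L1_int L1_continuous L1_cmult LH SH) auto
  also have "\<dots> = 2 * \<kappa> * integral {0..1} H" by simp
  also have "\<dots> \<le> 2 * \<kappa> * (2 * lam * I + (1 + M) * (S / \<sigma>))"
    using \<kappa> IqH by (intro mult_left_mono) auto
  also have "\<dots> = 4 * \<kappa> * lam * I + 2 * (\<kappa> * (1 + M) * (S / \<sigma>))" by (simp add: algebra_simps add_divide_distrib)
  also have "\<dots> \<le> 4 * \<kappa> * lam * I + 2 * (S / 4)" using frac by linarith
  finally have "S \<le> 8 * \<kappa> * lam * I" by simp
  then have "lam * (m * (y x)\<^sup>2) \<le> lam * (8 * \<kappa> * I)" using y2[OF x] by (simp add: \<sigma>2 mult_ac)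
  then have "m * (y x)\<^sup>2 \<le> 8 * \<kappa> * I" using lampos by simp
  then show ?thesis using m(1) by (simp add: \<kappa>_def I_def field_simps)
qed

text \<open>Above the threshold \<open>L\<close> the energy estimate applies. Between
  \<open>- \<Lambda>\<close> and \<open>L\<close> the L1 norm of \<open>q - lam w\<close> is at most
  \<open>P\<close>, and \<open>m\<close> converts \<open>\<integral> y\<^sup>2\<close> into the
  weighted norm. \<open>C\<close> is the larger of the two constants.\<close>

lemma sup_bound_by_weighted_norm:
  assumes w: "L1 w" and mon: "mono_on {0..1} w \<or> antimono_on {0..1} w"
    and m: "m > 0" "\<And>t. t \<in> {0..1} \<Longrightarrow> m \<le> w t" and W: "\<And>t. t \<in> {0..1} \<Longrightarrow> w t \<le> W"
  obtains C where "C > 0" "\<And>q lam y z x. L1 q \<Longrightarrow> integral {0..1} (\<lambda>t. \<bar>q t\<bar>) \<le> M \<Longrightarrow> - \<Lambda> \<le> lam \<Longrightarrow>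
           ac y z \<Longrightarrow> ac z (\<lambda>t. (q t - lam * w t) * y t) \<Longrightarrow> x \<in> {0..1} \<Longrightarrow>
           (y x)\<^sup>2 \<le> C * integral {0..1} (\<lambda>t. w t * (y t)\<^sup>2)"
proof -
  have W0: "0 < W" using m(1) m(2)[of 0] W[of 0] by auto
  define L where "L = (4 * (W / m) * (1 + M))\<^sup>2 / m"
  define P where "P = \<bar>M\<bar> + max \<bar>\<Lambda>\<bar> L * W"
  have L0: "L \<ge> 0" using m(1) by (simp add: L_def)
  have P0: "P \<ge> 0" using W0 by (simp add: P_def max_def)
  define C where "C = max (8 * (W / m) / m) (8 * (2 + P) / m)"
  have C: "C > 0" using m W0 P0 by (simp add: C_def max_def)
  have "(y x)\<^sup>2 \<le> C * integral {0..1} (\<lambda>t. w t * (y t)\<^sup>2)"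
    if q: "L1 q" and M: "integral {0..1} (\<lambda>t. \<bar>q t\<bar>) \<le> M" and lam: "- \<Lambda> \<le> lam"
      and y: "ac y z" and z: "ac z (\<lambda>t. (q t - lam * w t) * y t)" and x: "x \<in> {0..1}" for q lam y z x
  proof -
    define I where "I = integral {0..1} (\<lambda>t. w t * (y t)\<^sup>2)"
    have cy: "continuous_on {0..1} y" using ac_continuous[OF y] .
    have Ly: "L1 (\<lambda>t. (y t)\<^sup>2)" by (intro L1_continuous continuous_intros cy)
    have Lw: "L1 (\<lambda>t. w t * (y t)\<^sup>2)" by (intro L1_mult_continuous(2) w continuous_intros cy)
    have mI: "m * integral {0..1} (\<lambda>t. (y t)\<^sup>2) \<le> I"
    proof -
      have "integral {0..1} (\<lambda>t. m * (y t)\<^sup>2) \<le> I"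
        unfolding I_def using m(2) by (intro integral_le L1_int L1_cmult Ly Lw) (auto intro: mult_right_mono)
      then show ?thesis by simp
    qed
    have "0 \<le> integral {0..1} (\<lambda>t. (y t)\<^sup>2)" by (intro integral_nonneg L1_int Ly) auto
    then have I0: "0 \<le> I" using mI m(1) by (meson less_imp_le mult_nonneg_nonneg order_trans)
    have "(y x)\<^sup>2 \<le> 8 * (W / m) / m * I \<or> (y x)\<^sup>2 \<le> 8 * (2 + P) / m * I"
    proof (cases "L \<le> lam")
      case True
      then show ?thesis
        using sup_bound_large_eigenparameter[OF y z q w mon m W M _ x] unfolding L_def I_def by blast
    next
      case False
      have p: "L1 (\<lambda>t. q t - lam * w t)" by (intro L1_diff q L1_cmult w)
      have "\<bar>lam\<bar> \<le> max \<bar>\<Lambda>\<bar> L" using False lam by (auto simp: abs_le_iff le_max_iff_disj)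
      have "integral {0..1} (\<lambda>t. \<bar>q t - lam * w t\<bar>) \<le> integral {0..1} (\<lambda>t. \<bar>q t\<bar> + max \<bar>\<Lambda>\<bar> L * W)"
      proof (rule integral_le)
        show "(\<lambda>t. \<bar>q t - lam * w t\<bar>) integrable_on {0..1}" by (intro L1_int L1_abs p) auto
        show "(\<lambda>t. \<bar>q t\<bar> + max \<bar>\<Lambda>\<bar> L * W) integrable_on {0..1}"
          by (intro L1_int L1_add L1_abs q L1_continuous) auto
        fix t :: real assume t: "t \<in> {0..1}"
        have "\<bar>w t\<bar> \<le> W" using W[OF t] m(1) m(2)[OF t] by linarith
        then have "\<bar>lam * w t\<bar> \<le> max \<bar>\<Lambda>\<bar> L * W"
          using \<open>\<bar>lam\<bar> \<le> max \<bar>\<Lambda>\<bar> L\<close> by (intro abs_mult_le)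
        then show "\<bar>q t - lam * w t\<bar> \<le> \<bar>q t\<bar> + max \<bar>\<Lambda>\<bar> L * W"
          using abs_triangle_ineq4[of "q t" "lam * w t"] by linarith
      qed
      also have "\<dots> = integral {0..1} (\<lambda>t. \<bar>q t\<bar>) + max \<bar>\<Lambda>\<bar> L * W"
        using integral_add[OF L1_int[OF L1_abs[OF q], of 0 1] integrable_const_ivl[of "max \<bar>\<Lambda>\<bar> L * W" 0 1]] by simp
      also have "\<dots> \<le> P" using M by (simp add: P_def)
      finally have "(y x)\<^sup>2 \<le> 8 * (2 + P) * integral {0..1} (\<lambda>t. (y t)\<^sup>2)"
        by (intro sup_bound_by_potential[OF y z p _ x])
      also have "\<dots> \<le> 8 * (2 + P) * (I / m)"
        using P0 mI m(1) by (intro mult_left_mono) (auto simp: pos_le_divide_eq mult.commute)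
      finally show ?thesis by simp
    qed
    moreover have "8 * (W / m) / m * I \<le> C * I" "8 * (2 + P) / m * I \<le> C * I"
      unfolding C_def by (intro mult_right_mono I0 max.cobounded1 max.cobounded2)+
    ultimately show ?thesis unfolding I_def by linarith
  qed
  with C show ?thesis by (rule that)
qed

section \<open>Raising the eigenparameter against a change of potential\<close>

text \<open>The rate is linear in the distance of the coefficients. In the difference formula the
  factor is multiplied by \<open>p2 - p1\<close> once more, so replacing it by its diagonal value
  costs only a quadratic error.\<close>

lemma pfactor_continuity:
  assumes p: "L1 p1" "L1 p2" and B: "integral {0..1} (\<lambda>t. \<bar>p1 t\<bar>) \<le> B" "integral {0..1} (\<lambda>t. \<bar>p2 t\<bar>) \<le> B"
    and x: "x \<in> {0..1}"
  shows "\<bar>pfactor a p1 p2 x - pfactor a p1 p1 x\<bar>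
      \<le> exp (1 + B) * (1 + 2 * exp (2 * (1 + B)) * (1 + B)) * integral {0..1} (\<lambda>t. \<bar>p2 t - p1 t\<bar>)"
proof -
  define D where "D = integral {0..1} (\<lambda>t. \<bar>p2 t - p1 t\<bar>)"
  define e where "e = exp (2 * (1 + B)) * D"
  define \<theta> where "\<theta> = pangle a p1"
  define \<phi> where "\<phi> = pangle a p2"
  have c: "continuous_on {0..1} \<theta>" "continuous_on {0..1} \<phi>"
    unfolding \<theta>_def \<phi>_def by (intro continuous_on_pangle p)+
  have Ld: "L1 (\<lambda>t. p2 t - p1 t)" by (intro L1_diff p)
  have D0: "D \<ge> 0" unfolding D_def by (intro integral_nonneg L1_int L1_abs Ld) auto
  have e0: "e \<ge> 0" using D0 by (simp add: e_def)
  have d: "\<bar>\<phi> t - \<theta> t\<bar> \<le> e" if "t \<in> {0..1}" for t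
    unfolding \<theta>_def \<phi>_def e_def D_def by (rule pangle_lipschitz[OF p that B(2)])
  define k where "k = pkernel p2 \<theta> \<phi>"
  define k0 where "k0 = pkernel p1 \<theta> \<theta>"
  have Lk: "L1 k" "L1 k0" unfolding k_def k0_def by (intro L1_pkernel p c)+
  have kk: "\<bar>k t - k0 t\<bar> \<le> \<bar>p2 t - p1 t\<bar> + 2 * e * (1 + \<bar>p1 t\<bar>)" if t: "t \<in> {0..1}" for t
  proof -
    define s where "s = \<phi> t - \<theta> t"
    have ss: "\<bar>s\<bar> \<le> e" using d[OF t] by (simp add: s_def)
    \<comment> \<open>Three changes are separated: the coefficient, \<open>sinc s\<close> against
      its value 1 at 0, and the sum of the angles inside the sine.\<close>
    have eq: "k t - k0 t = (p2 t - p1 t) * (sin (\<phi> t + \<theta> t) * sinc s)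
        + (p1 t - 1) * (sin (\<phi> t + \<theta> t) * (sinc s - 1) + (sin (\<phi> t + \<theta> t) - sin (\<theta> t + \<theta> t)))"
      by (simp add: k_def k0_def pkernel_def s_def sinc_def algebra_simps)
    have 1: "\<bar>sin (\<phi> t + \<theta> t) * sinc s\<bar> \<le> 1 * 1"
      by (intro abs_mult_le abs_sinc_le abs_sin_le_one)
    have 2: "\<bar>sin (\<phi> t + \<theta> t) * (sinc s - 1)\<bar> \<le> 1 * \<bar>s\<bar>"
      by (intro abs_mult_le abs_sinc_minus_1_le abs_sin_le_one)
    have 3: "\<bar>sin (\<phi> t + \<theta> t) - sin (\<theta> t + \<theta> t)\<bar> \<le> \<bar>s\<bar>"
    proof -
      have "sin (\<phi> t + \<theta> t) - sin (\<theta> t + \<theta> t) = 2 * sin (s / 2) * cos ((\<phi> t + \<theta> t + (\<theta> t + \<theta> t)) / 2)"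
        unfolding sin_diff_sin by (simp add: s_def)
      also have "\<bar>\<dots>\<bar> \<le> 2 * \<bar>s / 2\<bar> * 1"
        unfolding abs_mult by (intro mult_mono abs_sin_x_le_abs_x) auto
      finally show ?thesis by simp
    qed
    have 4: "\<bar>(p2 t - p1 t) * (sin (\<phi> t + \<theta> t) * sinc s)\<bar> \<le> \<bar>p2 t - p1 t\<bar> * 1"
      using 1 by (intro abs_mult_le) simp_all
    have "\<bar>sin (\<phi> t + \<theta> t) * (sinc s - 1) + (sin (\<phi> t + \<theta> t) - sin (\<theta> t + \<theta> t))\<bar> \<le> 2 * e"
      using 2 3 ss by linarith
    then have 5: "\<bar>(p1 t - 1) * (sin (\<phi> t + \<theta> t) * (sinc s - 1) + (sin (\<phi> t + \<theta> t) - sin (\<theta> t + \<theta> t)))\<bar> \<le> (1 + \<bar>p1 t\<bar>) * (2 * e)"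
      by (intro abs_mult_le) linarith
    show ?thesis
      unfolding eq mult.commute[of "2 * e"]
      by (rule order_trans[OF abs_triangle_ineq add_mono[OF 4[unfolded mult_1_right] 5]])
  qed
  have Kdiff: "\<bar>integral {0..x} k - integral {0..x} k0\<bar> \<le> D + 2 * e * (1 + B)"
  proof -
    have "integral {0..x} k - integral {0..x} k0 = integral {0..x} (\<lambda>t. k t - k0 t)"
      using x by (intro integral_diff[symmetric] L1_int Lk) auto
    then have "\<bar>integral {0..x} k - integral {0..x} k0\<bar> \<le> integral {0..x} (\<lambda>t. \<bar>k t - k0 t\<bar>)"
      using L1_integral_abs_mono[OF L1_diff[OF Lk], of 0 x] x by simp
    also have "\<dots> \<le> integral {0..1} (\<lambda>t. \<bar>k t - k0 t\<bar>)"
      using x by (intro L1_integral_abs_le L1_diff Lk) auto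
    also have "\<dots> \<le> integral {0..1} (\<lambda>t. \<bar>p2 t - p1 t\<bar> + 2 * e * (1 + \<bar>p1 t\<bar>))"
      by (intro integral_le L1_int L1_add L1_abs L1_diff Lk p L1_cmult L1_continuous kk continuous_intros) auto
    also have "\<dots> = D + integral {0..1} (\<lambda>t. 2 * e * (1 + \<bar>p1 t\<bar>))"
      unfolding D_def by (intro integral_add L1_int L1_add L1_abs L1_diff p L1_cmult L1_continuous continuous_intros) auto
    also have "integral {0..1} (\<lambda>t. 2 * e * (1 + \<bar>p1 t\<bar>)) = 2 * e * integral {0..1} (\<lambda>t. 1 + \<bar>p1 t\<bar>)" by simp
    also have "integral {0..1} (\<lambda>t. 1 + \<bar>p1 t\<bar>) = 1 + integral {0..1} (\<lambda>t. \<bar>p1 t\<bar>)"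
      using integral_add[OF integrable_const_ivl[of 1 0 1] L1_int[OF L1_abs[OF p(1)], of 0 1]] by simp
    finally have "\<bar>integral {0..x} k - integral {0..x} k0\<bar> \<le> D + 2 * e * (1 + integral {0..1} (\<lambda>t. \<bar>p1 t\<bar>))" .
    moreover have "2 * e * (1 + integral {0..1} (\<lambda>t. \<bar>p1 t\<bar>)) \<le> 2 * e * (1 + B)"
      using e0 B(1) by (intro mult_left_mono) auto
    ultimately show ?thesis by linarith
  qed
  have lip: "\<bar>exp u - exp v\<bar> \<le> exp c * \<bar>u - v\<bar>" if "u \<le> c" "v \<le> c" for u v c :: real
  proof -
    have *: "\<bar>exp u - exp v\<bar> \<le> exp c * \<bar>u - v\<bar>" if "v \<le> u" "u \<le> c" for u v :: real
    proof -
      have "exp u * (1 + (v - u)) \<le> exp u * exp (v - u)" by (intro mult_left_mono exp_ge_add_one_self) auto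
      then have "exp u - exp v \<le> exp u * (u - v)" by (simp add: exp_diff algebra_simps)
      also have "\<dots> \<le> exp c * (u - v)" using that by (intro mult_right_mono) auto
      finally show ?thesis using that by simp
    qed
    show ?thesis using *[of u v] *[of v u] that by (cases "v \<le> u") (auto simp: abs_minus_commute)
  qed
  have bd: "\<bar>integral {0..x} k\<bar> \<le> 1 + B" "\<bar>integral {0..x} k0\<bar> \<le> 1 + B"
    using abs_integral_pkernel_le[OF p(2) c x] abs_integral_pkernel_le[OF p(1) c(1) c(1) x] B by (auto simp: k_def k0_def)
  have "\<bar>pfactor a p1 p2 x - pfactor a p1 p1 x\<bar> = \<bar>exp (- integral {0..x} k) - exp (- integral {0..x} k0)\<bar>"
    by (simp add: pfactor_def k_def k0_def \<theta>_def \<phi>_def)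
  also have "\<dots> \<le> exp (1 + B) * \<bar>- integral {0..x} k - (- integral {0..x} k0)\<bar>"
    using bd by (intro lip) auto
  also have "\<dots> \<le> exp (1 + B) * (D + 2 * e * (1 + B))"
    using Kdiff by (intro mult_left_mono) auto
  also have "\<dots> = exp (1 + B) * (1 + 2 * exp (2 * (1 + B)) * (1 + B)) * D"
    by (simp add: e_def algebra_simps)
  finally show ?thesis unfolding D_def .
qed

text \<open>Along the straight path from \<open>q1\<close> to \<open>q2\<close> the derivative of the angle at \<open>1\<close> is a positive
  multiple of \<open>\<integral> (C D w - (q2 - q1)) y\<^sup>2\<close>, which is nonnegative by the bound on \<open>y\<^sup>2\<close>.\<close>
lemma pangle_le_after_shift:
  assumes w: "L1 w" and q: "L1 q1" "L1 q2"
    and M: "integral {0..1} (\<lambda>t. \<bar>q1 t\<bar>) \<le> M" "integral {0..1} (\<lambda>t. \<bar>q2 t\<bar>) \<le> M"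
    and C: "C \<ge> 0" "\<And>q l y z x. L1 q \<Longrightarrow> integral {0..1} (\<lambda>t. \<bar>q t\<bar>) \<le> M \<Longrightarrow> lam \<le> l \<Longrightarrow>
           ac y z \<Longrightarrow> ac z (\<lambda>t. (q t - l * w t) * y t) \<Longrightarrow> x \<in> {0..1} \<Longrightarrow>
           (y x)\<^sup>2 \<le> C * integral {0..1} (\<lambda>t. w t * (y t)\<^sup>2)"
  shows "pangle a (\<lambda>t. lam * w t - q1 t) 1
      \<le> pangle a (\<lambda>t. (lam + C * integral {0..1} (\<lambda>t. \<bar>q1 t - q2 t\<bar>)) * w t - q2 t) 1"
proof -
  define D where "D = integral {0..1} (\<lambda>t. \<bar>q1 t - q2 t\<bar>)"
  have Lq: "L1 (\<lambda>t. q1 t - q2 t)" by (intro L1_diff q)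
  have D0: "0 \<le> D" unfolding D_def by (intro integral_nonneg L1_int L1_abs Lq) auto
  \<comment> \<open>\<open>p s\<close> belongs to the eigenparameter \<open>lam + s C D\<close> and
    the potential \<open>(1 - s) q1 + s q2\<close>, whose norm is at most \<open>M\<close> by
    convexity.\<close>
  define h where "h = (\<lambda>t. C * D * w t + (q1 t - q2 t))"
  define p where "p = (\<lambda>s t. (lam * w t - q1 t) + s * h t)"
  have Lh: "L1 h" unfolding h_def by (intro L1_add L1_cmult w Lq)
  have Lp: "L1 (p s)" for s unfolding p_def by (intro L1_add L1_diff L1_cmult w q Lh)
  define N where "N = integral {0..1} (\<lambda>t. \<bar>h t\<bar>)"
  have N0: "0 \<le> N" unfolding N_def by (intro integral_nonneg L1_int L1_abs Lh) auto
  define B where "B = integral {0..1} (\<lambda>t. \<bar>lam * w t - q1 t\<bar>) + N"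
  have B: "integral {0..1} (\<lambda>t. \<bar>p s t\<bar>) \<le> B" if "s \<in> {0..1}" for s
  proof -
    have "integral {0..1} (\<lambda>t. \<bar>p s t\<bar>) \<le> integral {0..1} (\<lambda>t. \<bar>lam * w t - q1 t\<bar> + \<bar>h t\<bar>)"
    proof (intro integral_le L1_int L1_add L1_abs Lp L1_diff L1_cmult w q Lh order.refl)
      fix t
      have "\<bar>s * h t\<bar> \<le> 1 * \<bar>h t\<bar>" unfolding abs_mult using that by (intro mult_right_mono) auto
      then show "\<bar>p s t\<bar> \<le> \<bar>lam * w t - q1 t\<bar> + \<bar>h t\<bar>" unfolding p_def by linarith
    qed
    also have "\<dots> = B"
      unfolding B_def N_def by (intro integral_add L1_int L1_abs L1_diff L1_cmult w q Lh order.refl)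
    finally show ?thesis .
  qed
  define c1 where "c1 = exp (1 + B) * (1 + 2 * exp (2 * (1 + B)) * (1 + B))"
  have B0: "0 \<le> B" using B[of 0] integral_nonneg[OF L1_int[OF L1_abs[OF Lp[of 0]]], of 0 1] by auto
  have c1: "0 \<le> c1" using B0 by (simp add: c1_def)
  define K where "K = exp (1 + B) * (c1 * N * N)"
  have K0: "0 \<le> K" using c1 N0 by (simp add: K_def)
  \<comment> \<open>The diagonal factor times the squared sine is \<open>y\<^sup>2\<close> for the
    Pruefer solution, so the integral is \<open>C D \<integral> w y\<^sup>2 + \<integral> (q1 - q2)
    y\<^sup>2\<close>, and the pointwise bound on \<open>y\<^sup>2\<close> controls the second
    summand by the first.\<close>
  have pos: "0 \<le> integral {0..1} (\<lambda>t. pfactor a (p s) (p s) t * (h t * (sin (pangle a (p s) t))\<^sup>2))"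
    if s: "s \<in> {0..1}" for s
  proof -
    define \<theta> where "\<theta> = pangle a (p s)"
    define \<rho> where "\<rho> = (\<lambda>x. exp (- (1/2) * integral {0..x} (pkernel (p s) \<theta> \<theta>)))"
    define y where "y = (\<lambda>x. \<rho> x * sin (\<theta> x))"
    define q where "q = (\<lambda>t. (1 - s) * q1 t + s * q2 t)"
    define l where "l = lam + s * (C * D)"
    have \<theta>: "ac \<theta> (\<lambda>t. pruefer_rhs (p s t) (\<theta> t))" unfolding \<theta>_def by (rule pangle(1)[OF Lp])
    have acy: "ac y (\<lambda>x. \<rho> x * cos (\<theta> x))"
      unfolding y_def \<rho>_def by (rule pruefer_solution(1)[OF \<theta> Lp])
    have "ac (\<lambda>x. \<rho> x * cos (\<theta> x)) (\<lambda>x. - p s x * y x)"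
      unfolding y_def \<rho>_def by (rule pruefer_solution(2)[OF \<theta> Lp])
    then have acz: "ac (\<lambda>x. \<rho> x * cos (\<theta> x)) (\<lambda>x. (q x - l * w x) * y x)"
      by (rule ac_cong) (simp_all add: p_def q_def l_def h_def algebra_simps)
    have Lqs: "L1 q" unfolding q_def by (intro L1_add L1_cmult assms)
    have "integral {0..1} (\<lambda>t. \<bar>q t\<bar>) \<le> integral {0..1} (\<lambda>t. (1 - s) * \<bar>q1 t\<bar> + s * \<bar>q2 t\<bar>)"
    proof (intro integral_le L1_int L1_abs L1_add L1_cmult assms Lqs order.refl)
      fix t
      show "\<bar>q t\<bar> \<le> (1 - s) * \<bar>q1 t\<bar> + s * \<bar>q2 t\<bar>"
        using abs_triangle_ineq[of "(1 - s) * q1 t" "s * q2 t"] s by (simp add: q_def abs_mult)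
    qed
    also have "\<dots> = integral {0..1} (\<lambda>t. (1 - s) * \<bar>q1 t\<bar>) + integral {0..1} (\<lambda>t. s * \<bar>q2 t\<bar>)"
      by (intro integral_add L1_int L1_cmult L1_abs assms order.refl)
    also have "\<dots> = (1 - s) * integral {0..1} (\<lambda>t. \<bar>q1 t\<bar>) + s * integral {0..1} (\<lambda>t. \<bar>q2 t\<bar>)" by simp
    also have "\<dots> \<le> (1 - s) * M + s * M" using M s by (intro add_mono mult_left_mono) auto
    finally have qM: "integral {0..1} (\<lambda>t. \<bar>q t\<bar>) \<le> M" by (simp add: algebra_simps)
    define I where "I = integral {0..1} (\<lambda>t. w t * (y t)\<^sup>2)"
    \<comment> \<open>The eigenparameter only rises along the path and thus stays where the bound is
      assumed.\<close>
    have "lam \<le> l" using s C(1) D0 by (simp add: l_def)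
    note yI = C(2)[OF Lqs qM this acy acz, folded I_def]
    have cy: "continuous_on {0..1} y" by (rule ac_continuous[OF acy])
    have Lw: "L1 (\<lambda>t. w t * (y t)\<^sup>2)" and Ld: "L1 (\<lambda>t. (q1 t - q2 t) * (y t)\<^sup>2)"
      by (intro L1_mult_continuous(2) w Lq continuous_intros cy)+
    have "\<bar>integral {0..1} (\<lambda>t. (q1 t - q2 t) * (y t)\<^sup>2)\<bar> \<le> integral {0..1} (\<lambda>t. \<bar>(q1 t - q2 t) * (y t)\<^sup>2\<bar>)"
      by (intro L1_integral_abs_mono Ld) auto
    also have "\<dots> \<le> integral {0..1} (\<lambda>t. (C * I) * \<bar>q1 t - q2 t\<bar>)"
      by (intro integral_le L1_int L1_abs L1_cmult Ld Lq order.refl)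
        (use yI in \<open>auto simp: abs_mult mult.commute[of "\<bar>q1 _ - q2 _\<bar>"] intro!: mult_right_mono\<close>)
    also have "\<dots> = C * I * D" by (simp add: D_def)
    finally have 1: "0 \<le> C * D * I + integral {0..1} (\<lambda>t. (q1 t - q2 t) * (y t)\<^sup>2)"
      by (simp only: mult_ac)
    have "C * D * I + integral {0..1} (\<lambda>t. (q1 t - q2 t) * (y t)\<^sup>2)
       = integral {0..1} (\<lambda>t. C * D * (w t * (y t)\<^sup>2)) + integral {0..1} (\<lambda>t. (q1 t - q2 t) * (y t)\<^sup>2)"
      by (simp add: I_def)
    also have "\<dots> = integral {0..1} (\<lambda>t. C * D * (w t * (y t)\<^sup>2) + (q1 t - q2 t) * (y t)\<^sup>2)"
      by (intro integral_add[symmetric] L1_int L1_cmult Lw Ld order.refl)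
    also have "\<dots> = integral {0..1} (\<lambda>t. pfactor a (p s) (p s) t * (h t * (sin (pangle a (p s) t))\<^sup>2))"
    proof (rule integral_cong)
      fix t
      have "(\<rho> t)\<^sup>2 = pfactor a (p s) (p s) t"
        by (simp add: \<rho>_def pfactor_def \<theta>_def power2_eq_square exp_add[symmetric])
      then have "(y t)\<^sup>2 = pfactor a (p s) (p s) t * (sin (pangle a (p s) t))\<^sup>2"
        by (simp add: y_def power_mult_distrib \<theta>_def)
      then show "C * D * (w t * (y t)\<^sup>2) + (q1 t - q2 t) * (y t)\<^sup>2
          = pfactor a (p s) (p s) t * (h t * (sin (pangle a (p s) t))\<^sup>2)"
        by (simp add: h_def algebra_simps)
    qed
    finally show ?thesis using 1 by simp
  qed
  define f where "f = (\<lambda>s. pangle a (p s) 1)"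
  \<comment> \<open>The exact difference formula carries the factor for the pair \<open>p s\<close>,
    \<open>p t\<close>. Its diagonal version gives a nonnegative integral; the replacement costs a
    multiple of \<open>t - s\<close>, and the increment \<open>(t - s) h\<close> of the coefficient
    supplies the second power.\<close>
  have step: "f s \<le> f t + K * (t - s)\<^sup>2" if st: "0 \<le> s" "s \<le> t" "t \<le> 1" for s t
  proof -
    have s: "s \<in> {0..1}" and t: "t \<in> {0..1}" using st by auto
    define S where "S = (\<lambda>x. (sin (pangle a (p s) x))\<^sup>2)"
    have S: "0 \<le> S x" "S x \<le> 1" for x by (auto simp: S_def abs_square_le_1)
    have cS: "continuous_on {0..1} S" unfolding S_def by (intro continuous_intros continuous_on_pangle Lp)
    have diff: "p t x - p s x = (t - s) * h x" for x by (simp add: p_def algebra_simps)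
    have cpf: "continuous_on {0..1} (pfactor a (p s) (p r))" for r
      unfolding pfactor_def
      by (intro continuous_intros indefinite_integral_continuous_1 L1_int L1_pkernel Lp continuous_on_pangle order.refl)
    have LhS: "L1 (\<lambda>x. h x * S x)" by (intro L1_mult_continuous(2) Lh cS)
    have L: "L1 (\<lambda>x. pfactor a (p s) (p r) x * (h x * S x))" for r
      by (intro L1_mult_continuous(1) LhS cpf)
    have close: "\<bar>pfactor a (p s) (p t) x - pfactor a (p s) (p s) x\<bar> \<le> c1 * ((t - s) * N)" if x: "x \<in> {0..1}" for x
    proof -
      have "integral {0..1} (\<lambda>x. \<bar>p t x - p s x\<bar>) = (t - s) * N"
        using st unfolding diff abs_mult by (simp add: N_def)
      then show ?thesis
        using pfactor_continuity[OF Lp Lp B[OF s] B[OF t] x, of a] by (simp add: c1_def)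
    qed
    have "integral {0..1} (\<lambda>x. pfactor a (p s) (p s) x * (h x * S x))
       - integral {0..1} (\<lambda>x. pfactor a (p s) (p t) x * (h x * S x))
       = integral {0..1} (\<lambda>x. pfactor a (p s) (p s) x * (h x * S x) - pfactor a (p s) (p t) x * (h x * S x))"
      by (intro integral_diff[symmetric] L1_int L order.refl)
    also have "\<dots> \<le> integral {0..1} (\<lambda>x. (c1 * ((t - s) * N)) * \<bar>h x\<bar>)"
    proof (intro integral_le L1_int L1_diff L L1_cmult L1_abs Lh order.refl)
      fix x :: real assume x: "x \<in> {0..1}"
      have "\<bar>h x * S x\<bar> \<le> \<bar>h x\<bar> * 1" using S[of x] by (intro abs_mult_le) simp_all
      then have "\<bar>pfactor a (p s) (p s) x - pfactor a (p s) (p t) x\<bar> * \<bar>h x * S x\<bar> \<le> (c1 * ((t - s) * N)) * (\<bar>h x\<bar> * 1)"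
        using close[OF x] c1 st N0 by (intro mult_mono) (auto simp: abs_minus_commute)
      moreover have "pfactor a (p s) (p s) x * (h x * S x) - pfactor a (p s) (p t) x * (h x * S x)
          \<le> \<bar>pfactor a (p s) (p s) x - pfactor a (p s) (p t) x\<bar> * \<bar>h x * S x\<bar>"
        unfolding left_diff_distrib[symmetric] abs_mult[symmetric] by (rule abs_ge_self)
      ultimately show "pfactor a (p s) (p s) x * (h x * S x) - pfactor a (p s) (p t) x * (h x * S x)
          \<le> (c1 * ((t - s) * N)) * \<bar>h x\<bar>" by simp
    qed
    also have "\<dots> = c1 * ((t - s) * N) * N" by (simp add: N_def)
    finally have low: "- (c1 * ((t - s) * N) * N) \<le> integral {0..1} (\<lambda>x. pfactor a (p s) (p t) x * (h x * S x))"
      using pos[OF s] by (simp add: S_def)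
    have "pfactor a (p s) (p t) 1 * (f t - f s) = integral {0..1} (\<lambda>x. pfactor a (p s) (p t) x * ((p t x - p s x) * S x))"
      using pangle_difference[OF Lp Lp, of 1 a s t] by (simp add: f_def S_def)
    also have "\<dots> = integral {0..1} (\<lambda>x. (t - s) * (pfactor a (p s) (p t) x * (h x * S x)))"
      by (simp add: diff mult_ac)
    also have "\<dots> = (t - s) * integral {0..1} (\<lambda>x. pfactor a (p s) (p t) x * (h x * S x))" by simp
    also have "\<dots> \<ge> (t - s) * - (c1 * ((t - s) * N) * N)" using st by (intro mult_left_mono low) auto
    finally have "- (c1 * N * N * (t - s)\<^sup>2) \<le> pfactor a (p s) (p t) 1 * (f t - f s)"
      by (simp add: power2_eq_square mult_ac)
    then have 1: "pfactor a (p s) (p t) 1 * (f s - f t) \<le> c1 * N * N * (t - s)\<^sup>2" by (simp add: right_diff_distrib)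
    show ?thesis
    proof (cases "f s \<le> f t")
      case True
      then show ?thesis using K0 by (simp add: add_increasing2)
    next
      case False
      have "exp (- (1 + B)) * (f s - f t) \<le> pfactor a (p s) (p t) 1 * (f s - f t)"
        using pfactor_bounds(1)[OF Lp Lp _ B[OF t], of 1 a s] False by (intro mult_right_mono) auto
      then have "exp (1 + B) * (exp (- (1 + B)) * (f s - f t)) \<le> exp (1 + B) * (c1 * N * N * (t - s)\<^sup>2)"
        using 1 by (intro mult_left_mono) auto
      then have "f s - f t \<le> K * (t - s)\<^sup>2"
        by (simp add: K_def mult.assoc[symmetric] exp_add[symmetric])
      then show ?thesis by simp
    qed
  qed
  have "f 0 \<le> f 1"
  proof (rule nondecreasing_if_locally_up_to_eps[where \<Phi> = f and \<mu> = "\<lambda>s. s"])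
    fix \<epsilon> :: real assume e: "\<epsilon> > 0"
    show "\<exists>\<delta>>0. \<forall>s t. 0 \<le> s \<and> s \<le> t \<and> t \<le> 1 \<and> t - s < \<delta> \<longrightarrow> f s \<le> f t + \<epsilon> * (t - s)"
    proof (intro exI[of _ "\<epsilon> / (K + 1)"] conjI allI impI)
      show "0 < \<epsilon> / (K + 1)" using e K0 by simp
      fix s t :: real assume *: "0 \<le> s \<and> s \<le> t \<and> t \<le> 1 \<and> t - s < \<epsilon> / (K + 1)"
      have "(K + 1) * (t - s) \<le> \<epsilon>" using * K0 by (simp add: field_simps)
      then have "K * (t - s) \<le> \<epsilon>" using * by (simp add: algebra_simps)
      then have "K * (t - s) * (t - s) \<le> \<epsilon> * (t - s)" using * by (intro mult_right_mono) auto
      then show "f s \<le> f t + \<epsilon> * (t - s)" using step[of s t] * by (simp add: power2_eq_square mult.assoc)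
    qed
  qed auto
  moreover have "p 0 = (\<lambda>t. lam * w t - q1 t)" by (simp add: p_def)
  moreover have "p 1 = (\<lambda>t. (lam + C * D) * w t - q2 t)" by (simp add: p_def h_def algebra_simps)
  ultimately show ?thesis by (simp add: f_def D_def)
qed

section \<open>Eigenvalues\<close>

text \<open>\<open>z\<close> is continuous as a primitive, so by the fundamental theorem the
  derivative condition on \<open>y\<close> is the same as the integral identity.\<close>

lemma sl_solution_iff:
  "sl_solution q w lam y z \<longleftrightarrow> ac y z \<and> ac z (\<lambda>t. (q t - lam * w t) * y t)"
proof
  assume s: "sl_solution q w lam y z"
  then have z: "ac z (\<lambda>t. (q t - lam * w t) * y t)" unfolding sl_solution_def ac_def by blast
  moreover have "ac y z"
    using s ac_continuous[OF z] unfolding sl_solution_def by (intro ac_from_deriv) blast+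
  ultimately show "ac y z \<and> ac z (\<lambda>t. (q t - lam * w t) * y t)" by blast
next
  assume "ac y z \<and> ac z (\<lambda>t. (q t - lam * w t) * y t)"
  then show "sl_solution q w lam y z"
    using ac_has_deriv[of y z] ac_continuous[of z "\<lambda>t. (q t - lam * w t) * y t"]
    unfolding sl_solution_def ac_def by blast
qed

text \<open>Gronwall backwards from 1: multiplied by \<open>exp\<close> of the primitive of
  \<open>1 + \<bar>g\<bar>\<close>, the sum \<open>u\<^sup>2 + v\<^sup>2\<close> is nondecreasing,
  and it ends at 0.\<close>

lemma solution_zero_if_zero_at_1:
  assumes u: "ac u v" and v: "ac v (\<lambda>t. g t * u t)" and g: "L1 g" and 0: "u 1 = 0" "v 1 = 0"
    and x: "x \<in> {0..1}"
  shows "u x = 0"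
proof -
  define k where "k = (\<lambda>t. 1 + \<bar>g t\<bar>)"
  have k: "L1 k" unfolding k_def by (intro L1_add L1_abs g L1_continuous continuous_intros)
  define E where "E = (\<lambda>x. exp (0 + integral {0..x} k))"
  have E: "ac E (\<lambda>x. E x * k x)" unfolding E_def by (rule ac_exp[OF ac_integral[OF k]])
  have "ac (\<lambda>x. E x * (u x * u x + v x * v x))
           (\<lambda>x. E x * k x * (u x * u x + v x * v x) + E x * ((v x * u x + u x * v x) + (g x * u x * v x + v x * (g x * u x))))"
    by (rule ac_mult[OF E ac_add[OF ac_mult[OF u u] ac_mult[OF v v]]])
  then have "E x * (u x * u x + v x * v x) \<le> E 1 * (u 1 * u 1 + v 1 * v 1)"
  proof (rule ac_mono)
    fix t :: real
    have "\<bar>2 * (u t * v t)\<bar> \<le> u t * u t + v t * v t"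
      using sum_squares_bound[of "u t" "v t"] sum_squares_bound[of "u t" "- v t"]
      by (auto simp: abs_le_iff power2_eq_square)
    then have "\<bar>(1 + g t) * (2 * (u t * v t))\<bar> \<le> k t * (u t * u t + v t * v t)"
      unfolding abs_mult[of "1 + g t"] k_def by (intro mult_mono) auto
    then have "0 \<le> k t * (u t * u t + v t * v t) + (1 + g t) * (2 * (u t * v t))" by linarith
    then have "0 \<le> E t * (k t * (u t * u t + v t * v t) + (1 + g t) * (2 * (u t * v t)))"
      by (simp add: E_def)
    then show "0 \<le> E t * k t * (u t * u t + v t * v t) + E t * ((v t * u t + u t * v t) + (g t * u t * v t + v t * (g t * u t)))"
      by (simp add: algebra_simps)
  qed (use x in auto)
  then have "E x * (u x * u x + v x * v x) \<le> 0" using 0 by simp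
  then have "u x * u x + v x * v x \<le> 0" by (simp add: E_def mult_le_0_iff)
  then show ?thesis using sum_squares_le_zero_iff[of "u x" "v x"] by simp
qed

lemma orthogonal_to_common_imp_det_zero:
  fixes a b c d p q :: real
  assumes "a * p + b * q = 0" "c * p + d * q = 0" "p \<noteq> 0 \<or> q \<noteq> 0"
  shows "a * d = b * c"
proof -
  have "(a * d - b * c) * p = (a * p + b * q) * d - b * (c * p + d * q)" by (simp add: algebra_simps)
  moreover have "(a * d - b * c) * q = a * (c * p + d * q) - (a * p + b * q) * c" by (simp add: algebra_simps)
  ultimately show ?thesis using assms by auto
qed

lemma cos_sin_not_both_zero: "cos (x::real) \<noteq> 0 \<or> sin x \<noteq> 0"
  by (metis add_0 power_zero_numeral sin_cos_squared_add zero_neq_one)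

text \<open>The Pruefer solution turns each boundary expression into
  \<open>\<rho> sin (\<theta> + \<gamma>)\<close> and meets the condition at 0. An eigenfunction
  meets it as well, so the Wronskian of the two vanishes and the condition at 1 carries over to the
  Pruefer solution.\<close>

lemma sl_eigenvalue_iff_pangle:
  assumes w: "L1 w" and q: "L1 q" and a: "sin (a + \<alpha>) = 0"
  shows "sl_eigenvalue \<alpha> \<beta> w q lam \<longleftrightarrow> sin (pangle a (\<lambda>t. lam * w t - q t) 1 + \<beta>) = 0"
proof -
  define p where "p = (\<lambda>t. lam * w t - q t)"
  have p: "L1 p" unfolding p_def by (intro L1_diff L1_cmult w q)
  define \<theta> where "\<theta> = pangle a p"
  have \<theta>: "ac \<theta> (\<lambda>t. pruefer_rhs (p t) (\<theta> t))" "\<theta> 0 = a" using pangle[OF p] by (auto simp: \<theta>_def)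
  define \<rho> where "\<rho> = (\<lambda>x. exp (- (1/2) * integral {0..x} (pkernel p \<theta> \<theta>)))"
  define y where "y = (\<lambda>x. \<rho> x * sin (\<theta> x))"
  define z where "z = (\<lambda>x. \<rho> x * cos (\<theta> x))"
  have y: "ac y z" unfolding y_def z_def \<rho>_def by (rule pruefer_solution(1)[OF \<theta>(1) p])
  have "ac z (\<lambda>x. - p x * y x)" unfolding y_def z_def \<rho>_def by (rule pruefer_solution(2)[OF \<theta>(1) p])
  then have z: "ac z (\<lambda>x. (q x - lam * w x) * y x)" by (rule ac_cong) (simp_all add: p_def)
  have \<rho>: "\<rho> x > 0" for x by (simp add: \<rho>_def)
  have bc: "y x * cos \<gamma> + z x * sin \<gamma> = \<rho> x * sin (\<theta> x + \<gamma>)" for x \<gamma>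
    by (simp add: y_def z_def sin_add algebra_simps)
  have bc0: "y 0 * cos \<alpha> + z 0 * sin \<alpha> = 0" unfolding bc using a \<theta>(2) by simp
  have "sl_eigenvalue \<alpha> \<beta> w q lam \<longleftrightarrow> sin (\<theta> 1 + \<beta>) = 0"
  proof
    assume s: "sin (\<theta> 1 + \<beta>) = 0"
    have "\<exists>x\<in>{0..1}. y x \<noteq> 0"
    proof (rule ccontr)
      assume "\<not> ?thesis"
      then have y0: "y x = 0" if "x \<in> {0..1}" for x using that by blast
      \<comment> \<open>If \<open>y\<close> vanished, \<open>z\<close> would be constant and, having
        integral 0, would vanish too; sine and cosine of the angle would then both be 0.\<close>
      have zc: "z x = z 0" if "x \<in> {0..1}" for x
        by (rule ac_zero_const[OF z]) (use y0 that in auto)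
      have "integral {0..1} z = integral {0..1} (\<lambda>x::real. z 0)" by (rule integral_cong) (rule zc)
      then have "z 0 = 0" using ac_eq[OF y, of 1] y0[of 1] y0[of 0] by simp
      then have "cos (\<theta> 0) = 0" "sin (\<theta> 0) = 0" using y0[of 0] \<rho>[of 0] by (auto simp: y_def z_def)
      then show False using cos_sin_not_both_zero by blast
    qed
    moreover have "y 1 * cos \<beta> + z 1 * sin \<beta> = 0" unfolding bc using s by simp
    ultimately show "sl_eigenvalue \<alpha> \<beta> w q lam"
      unfolding sl_eigenvalue_def sl_solution_iff using y z bc0 by blast
  next
    assume "sl_eigenvalue \<alpha> \<beta> w q lam"
    then obtain u v where u: "ac u v" and v: "ac v (\<lambda>t. (q t - lam * w t) * u t)"
      and nz: "\<exists>x\<in>{0..1}. u x \<noteq> 0" and b0: "u 0 * cos \<alpha> + v 0 * sin \<alpha> = 0" and b1: "u 1 * cos \<beta> + v 1 * sin \<beta> = 0"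
      unfolding sl_eigenvalue_def sl_solution_iff by blast
    \<comment> \<open>Wronskian of the eigenfunction and the Pruefer solution: its derivative
      cancels.\<close>
    have "ac (\<lambda>x. u x * z x - v x * y x) (\<lambda>x. (v x * z x + u x * ((q x - lam * w x) * y x)) - ((q x - lam * w x) * u x * y x + v x * z x))"
      by (rule ac_diff[OF ac_mult[OF u z] ac_mult[OF v y]])
    then have "u 1 * z 1 - v 1 * y 1 = u 0 * z 0 - v 0 * y 0"
      by (rule ac_zero_const[where f = "\<lambda>x. u x * z x - v x * y x"]) (auto simp: algebra_simps)
    also have "u 0 * z 0 = v 0 * y 0"
      by (rule orthogonal_to_common_imp_det_zero[OF b0 bc0 cos_sin_not_both_zero])
    finally have W: "u 1 * z 1 = v 1 * y 1" by simp
    have g: "L1 (\<lambda>t. q t - lam * w t)" by (intro L1_diff L1_cmult w q)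
    have "u 1 \<noteq> 0 \<or> v 1 \<noteq> 0" using solution_zero_if_zero_at_1[OF u v g] nz by blast
    moreover have "u 1 * (y 1 * cos \<beta> + z 1 * sin \<beta>) = 0"
    proof -
      have "u 1 * (y 1 * cos \<beta> + z 1 * sin \<beta>) = y 1 * (u 1 * cos \<beta> + v 1 * sin \<beta>) + (u 1 * z 1 - v 1 * y 1) * sin \<beta>"
        by (simp add: algebra_simps)
      then show ?thesis using b1 W by simp
    qed
    moreover have "v 1 * (y 1 * cos \<beta> + z 1 * sin \<beta>) = 0"
    proof -
      have "v 1 * (y 1 * cos \<beta> + z 1 * sin \<beta>) = z 1 * (u 1 * cos \<beta> + v 1 * sin \<beta>) - (u 1 * z 1 - v 1 * y 1) * cos \<beta>"
        by (simp add: algebra_simps)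
      then show ?thesis using b1 W by simp
    qed
    ultimately have "y 1 * cos \<beta> + z 1 * sin \<beta> = 0" by (metis mult_eq_0_iff)
    then show "sin (\<theta> 1 + \<beta>) = 0" unfolding bc using \<rho>[of 1] by simp
  qed
  then show ?thesis by (simp add: \<theta>_def p_def)
qed

section \<open>Numbering the eigenvalues by the angle\<close>

text \<open>Positivity leaves only the levels \<open>k pi\<close> with \<open>k \<ge> 1\<close>, and
  strict monotonicity attains each at most once. Since \<open>N L < pi\<close>, the intermediate
  value theorem attains every level below \<open>N x\<close>, so exactly \<open>k - 1\<close> zeros
  precede one at level \<open>k pi\<close>.\<close>

lemma nth_zero_of_sin_iff:
  fixes N :: "real \<Rightarrow> real"
  assumes mono: "strict_mono N" and cont: "continuous_on UNIV N" and pos: "\<And>x. 0 < N x"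
    and L: "N L < pi" and n: "n \<ge> 1"
  defines "E \<equiv> {x. sin (N x) = 0}"
  shows "x \<in> E \<and> finite {y \<in> E. y < x} \<and> card {y \<in> E. y < x} = n - 1 \<longleftrightarrow> N x = real n * pi"
proof -
  have E: "\<exists>k\<ge>1. N x = real k * pi" if "x \<in> E" for x
  proof -
    have "sin (N x) = 0" using that by (simp add: E_def)
    then obtain i :: int where i: "N x = real_of_int i * pi" unfolding sin_zero_iff_int2 by blast
    then have "0 < real_of_int i" using pos[of x] by (simp add: zero_less_mult_iff)
    then show ?thesis using i by (intro exI[of _ "nat i"]) auto
  qed
  have in_E: "x \<in> E" if "N x = real k * pi" for x k
    using that sin_npi[of k] by (simp add: E_def)
  have count: "finite {y \<in> E. y < x} \<and> card {y \<in> E. y < x} = k - 1" if k: "k \<ge> 1" "N x = real k * pi" for x k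
  proof -
    let ?T = "{y \<in> E. y < x}"
    have inj: "inj_on N ?T" using strict_mono_imp_inj_on[OF mono] inj_on_subset by blast
    have "N ` ?T = (\<lambda>j. real j * pi) ` {1..<k}"
    proof (intro equalityI subsetI)
      fix r assume "r \<in> N ` ?T"
      then obtain y where y: "y \<in> E" "y < x" "r = N y" by auto
      obtain j where j: "j \<ge> 1" "N y = real j * pi" using E[OF y(1)] by blast
      have "N y < N x" using mono y(2) by (simp add: strict_mono_less)
      then have "j < k" using j k by simp
      then show "r \<in> (\<lambda>j. real j * pi) ` {1..<k}" using j y by auto
    next
      fix r assume "r \<in> (\<lambda>j. real j * pi) ` {1..<k}"
      then obtain j where j: "1 \<le> j" "j < k" "r = real j * pi" by auto
      have "1 * pi \<le> real j * pi" using j by (intro mult_right_mono) auto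
      then have Lr: "N L < r" unfolding j(3) using L by linarith
      have rx: "r < N x" using j k by simp
      then have "L \<le> x" using Lr mono by (metis less_le_not_le less_trans not_le_imp_less order.strict_implies_order strict_mono_less)
      then obtain y where y: "L \<le> y" "y \<le> x" "N y = r"
        using IVT'[of N L r x] Lr rx continuous_on_subset[OF cont] by auto
      then have "y < x" using rx by (cases "y = x") auto
      then have "y \<in> ?T" using y in_E[of y j] j by auto
      then show "r \<in> N ` ?T" by (rule rev_image_eqI) (simp add: y(3))
    qed
    moreover have "inj_on (\<lambda>j. real j * pi) {1..<k}" by (auto simp: inj_on_def)
    ultimately have "card (N ` ?T) = k - 1" "finite (N ` ?T)" by (simp_all add: card_image)
    then show ?thesis using inj by (simp add: card_image finite_image_iff)
  qed
  show ?thesis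
  proof
    assume *: "x \<in> E \<and> finite {y \<in> E. y < x} \<and> card {y \<in> E. y < x} = n - 1"
    then obtain k where k: "k \<ge> 1" "N x = real k * pi" using E by blast
    \<comment> \<open>Both \<open>k\<close> and \<open>n\<close> are at least 1, so truncated
      subtraction loses nothing.\<close>
    then have "k - 1 = n - 1" using count * by auto
    then show "N x = real n * pi" using k n by simp
  qed (use count n in_E in blast)
qed

lemma pangle_eigenparameter:
  assumes w: "L1 w" and q: "L1 q" and m: "m > 0" "\<And>t. t \<in> {0..1} \<Longrightarrow> m \<le> w t"
  shows "strict_mono (\<lambda>lam. pangle a (\<lambda>t. lam * w t - q t) 1)"
    and "continuous_on UNIV (\<lambda>lam. pangle a (\<lambda>t. lam * w t - q t) 1)"
proof -
  have p: "L1 (\<lambda>t. lam * w t - q t)" for lam by (intro L1_diff L1_cmult w q)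
  show "strict_mono (\<lambda>lam. pangle a (\<lambda>t. lam * w t - q t) 1)"
  proof (rule strict_monoI)
    fix l k :: real assume lk: "l < k"
    show "pangle a (\<lambda>t. l * w t - q t) 1 < pangle a (\<lambda>t. k * w t - q t) 1"
    proof (rule pangle_strict_mono[OF p p, of "(k - l) * m"])
      show "0 < (k - l) * m" using lk m by simp
      show "l * w t - q t + (k - l) * m \<le> k * w t - q t" if "t \<in> {0..1}" for t
        using mult_left_mono[OF m(2)[OF that], of "k - l"] lk by (simp add: algebra_simps)
    qed
  qed
  show "continuous_on UNIV (\<lambda>lam. pangle a (\<lambda>t. lam * w t - q t) 1)"
    unfolding continuous_on_eq_continuous_at[OF open_UNIV]
  proof
    fix l :: real
    \<comment> \<open>The norm bound is taken at the fixed point \<open>l\<close>, which keeps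
      \<open>c\<close> independent of \<open>k\<close>.\<close>
    define c where "c = exp (2 * (1 + integral {0..1} (\<lambda>t. \<bar>l * w t - q t\<bar>))) * integral {0..1} (\<lambda>t. \<bar>w t\<bar>)"
    have lip: "\<bar>pangle a (\<lambda>t. k * w t - q t) 1 - pangle a (\<lambda>t. l * w t - q t) 1\<bar> \<le> c * \<bar>k - l\<bar>" for k
    proof -
      have "(\<lambda>t. \<bar>l * w t - q t - (k * w t - q t)\<bar>) = (\<lambda>t. \<bar>k - l\<bar> * \<bar>w t\<bar>)"
        by (simp add: abs_mult[symmetric] abs_minus_commute[of "l * _"] left_diff_distrib)
      then show ?thesis
        using pangle_lipschitz[OF p p, of 1 l _ a k, OF _ order.refl]
        by (simp add: c_def abs_minus_commute mult_ac)
    qed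
    have "((\<lambda>k. c * \<bar>k - l\<bar>) \<longlongrightarrow> c * \<bar>l - l\<bar>) (at l)" by (intro tendsto_intros)
    then have "((\<lambda>k. c * \<bar>k - l\<bar>) \<longlongrightarrow> 0) (at l)" by simp
    then have "((\<lambda>k. pangle a (\<lambda>t. k * w t - q t) 1 - pangle a (\<lambda>t. l * w t - q t) 1) \<longlongrightarrow> 0) (at l)"
      by (rule Lim_null_comparison[rotated]) (use lip in \<open>simp add: always_eventually\<close>)
    then show "isCont (\<lambda>lam. pangle a (\<lambda>t. lam * w t - q t) 1) l"
      unfolding isCont_def by (rule LIM_zero_cancel)
  qed
qed

text \<open>If \<open>l\<close> is at level \<open>n pi\<close> for \<open>q1\<close>, raising it by
  \<open>C\<close> times the distance brings the angle of \<open>q2\<close> to that level or beyond,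
  so the \<open>n\<close>-th eigenvalue of \<open>q2\<close> lies no higher. Exchanging the
  potentials gives the other inequality. \<open>C\<close> is fixed before \<open>n\<close> and the
  potentials are.\<close>

lemma sl_eig_lipschitz:
  fixes \<alpha> \<beta> M :: real and w :: "real \<Rightarrow> real"
  assumes \<alpha>: "0 \<le> \<alpha>" "\<alpha> < pi" and \<beta>: "0 \<le> \<beta>" "\<beta> < pi" and w: "L1 w"
    and H1: "mono_on {0..1} w \<or> antimono_on {0..1} w"
    and H2: "(INF x\<in>{0..1}. w x) > 0"
  obtains C where "C > 0" "\<And>n q1 q2. n \<ge> 1 \<Longrightarrow> L1 q1 \<Longrightarrow> L1 q2 \<Longrightarrow>
      integral {0..1} (\<lambda>x. \<bar>q1 x\<bar>) \<le> M \<Longrightarrow> integral {0..1} (\<lambda>x. \<bar>q2 x\<bar>) \<le> M \<Longrightarrow>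
      \<bar>sl_eig \<alpha> \<beta> w q1 n - sl_eig \<alpha> \<beta> w q2 n\<bar> \<le> C * integral {0..1} (\<lambda>x. \<bar>q1 x - q2 x\<bar>)"
proof -
  define \<Omega> where "\<Omega> = {q. L1 q \<and> integral {0..1} (\<lambda>x. \<bar>q x\<bar>) \<le> M}"
  have L\<Omega>: "\<forall>q\<in>\<Omega>. L1 q" and M: "\<forall>q\<in>\<Omega>. integral {0..1} (\<lambda>x. \<bar>q x\<bar>) \<le> M"
    by (auto simp: \<Omega>_def)
  define m where "m = (INF x\<in>{0..1}. w x)"
  define W where "W = max (w 0) (w 1)"
  have w01: "min (w 0) (w 1) \<le> w t \<and> w t \<le> W" if "t \<in> {0..1}" for t
    using H1
  proof
    assume "mono_on {0..1} w"
    then have "w 0 \<le> w t" "w t \<le> w 1" using that by (auto simp: mono_on_def)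
    then show ?thesis by (auto simp: W_def)
  next
    assume "antimono_on {0..1} w"
    then have "w t \<le> w 0" "w 1 \<le> w t" using that by (auto simp: monotone_on_def)
    then show ?thesis by (auto simp: W_def)
  qed
  \<comment> \<open>Only for a set bounded below is the real infimum in \<open>H2\<close> known to
    be a lower bound.\<close>
  have bdd: "bdd_below (w ` {0..1})" by (rule bdd_belowI2[where m = "min (w 0) (w 1)"]) (use w01 in blast)
  have m: "m > 0" "\<And>t. t \<in> {0..1} \<Longrightarrow> m \<le> w t"
    using H2 cINF_lower[OF bdd] by (auto simp: m_def)
  have W: "\<And>t. t \<in> {0..1} \<Longrightarrow> w t \<le> W" using w01 by blast
  \<comment> \<open>The initial angle must lie in [0, pi); for \<open>\<alpha> = 0\<close> the
    formula \<open>pi - \<alpha>\<close> would give pi and shift the numbering by one.\<close>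
  define a where "a = (if \<alpha> = 0 then 0 else pi - \<alpha>)"
  have a: "0 \<le> a" "a < pi" "sin (a + \<alpha>) = 0" using \<alpha> by (auto simp: a_def)
  \<comment> \<open>\<open>M\<close> may be negative, namely when no potential satisfies the bound;
    hence \<open>max M 0\<close>.\<close>
  obtain \<Lambda> where "\<Lambda> > 0" and \<Lambda>: "\<And>w q lam. L1 w \<Longrightarrow> L1 q \<Longrightarrow> \<forall>t\<in>{0..1}. m \<le> w t \<Longrightarrow>
           integral {0..1} (\<lambda>t. \<bar>q t\<bar>) \<le> max M 0 \<Longrightarrow> lam \<le> - \<Lambda> \<Longrightarrow> pangle a (\<lambda>t. lam * w t - q t) 1 < pi - \<beta>"
    by (rule pangle_less_for_very_negative[OF a(2) \<beta>(2) m(1) max.cobounded2[of 0 M]]) (rule that)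
  obtain C where C0: "C > 0" and C1: "\<And>q lam y z x. L1 q \<Longrightarrow> integral {0..1} (\<lambda>t. \<bar>q t\<bar>) \<le> M \<Longrightarrow> - \<Lambda> \<le> lam \<Longrightarrow>
           ac y z \<Longrightarrow> ac z (\<lambda>t. (q t - lam * w t) * y t) \<Longrightarrow> x \<in> {0..1} \<Longrightarrow>
           (y x)\<^sup>2 \<le> C * integral {0..1} (\<lambda>t. w t * (y t)\<^sup>2)"
    by (rule sup_bound_by_weighted_norm[OF w H1 m W, of M \<Lambda>]) (assumption | rule that)+
  \<comment> \<open>Adding \<open>\<beta>\<close> puts the condition at 1 on the multiples of pi:
    eigenvalues are the zeros of \<open>sin (N q lam)\<close>.\<close>
  define N where "N = (\<lambda>q lam. pangle a (\<lambda>t. lam * w t - q t) 1 + \<beta>)"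
  have N_mono: "strict_mono (N q)" and N_cont: "continuous_on UNIV (N q)" and N_pos: "0 < N q lam"
    and N_low: "lam \<le> - \<Lambda> \<Longrightarrow> N q lam < pi" if "q \<in> \<Omega>" for q lam
  proof -
    have q: "L1 q" using L\<Omega> that by blast
    show "strict_mono (N q)"
      using pangle_eigenparameter(1)[OF w q m, of a] by (simp add: N_def strict_mono_def)
    show "continuous_on UNIV (N q)"
      unfolding N_def by (intro continuous_intros pangle_eigenparameter(2)[OF w q m])
    have "L1 (\<lambda>t. lam * w t - q t)" by (intro L1_diff L1_cmult w q)
    from pangle_pos[OF this a(1)] show "0 < N q lam" using \<beta>(1) by (simp add: N_def)
    have "integral {0..1} (\<lambda>t. \<bar>q t\<bar>) \<le> max M 0" using M that by (simp add: le_max_iff_disj)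
    then show "N q lam < pi" if "lam \<le> - \<Lambda>"
      using \<Lambda>[OF w q _ _ that] m(2) by (simp add: N_def less_diff_eq)
  qed
  have eig: "sl_eig \<alpha> \<beta> w q n = (THE lam. N q lam = real n * pi)" if q: "q \<in> \<Omega>" and n: "n \<ge> 1" for q n
  proof -
    have "sl_eigenvalue \<alpha> \<beta> w q lam \<longleftrightarrow> lam \<in> {x. sin (N q x) = 0}" for lam
      using sl_eigenvalue_iff_pangle[OF w _ a(3), of q \<beta> lam] L\<Omega> q by (simp add: N_def)
    then show ?thesis
      unfolding sl_eig_def
      using nth_zero_of_sin_iff[OF N_mono[OF q] N_cont[OF q] N_pos[OF q] N_low[OF q order.refl] n] by simp
  qed
  have unique: "l = k" if "q \<in> \<Omega>" "N q l = r" "N q k = r" for q l k r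
    using strict_mono_eq[OF N_mono[OF that(1)], of l k] that(2,3) by simp
  have shift: "\<exists>k. N q2 k = real n * pi \<and> k \<le> l + C * integral {0..1} (\<lambda>x. \<bar>q1 x - q2 x\<bar>)"
    if q: "q1 \<in> \<Omega>" "q2 \<in> \<Omega>" and n: "n \<ge> 1" and l: "N q1 l = real n * pi" for q1 q2 n l
  proof -
    define k where "k = l + C * integral {0..1} (\<lambda>x. \<bar>q1 x - q2 x\<bar>)"
    have np: "pi \<le> real n * pi" using n by simp
    \<comment> \<open>At or below \<open>- \<Lambda>\<close> the level is still less than pi, so
      \<open>l\<close> lies in the range covered by \<open>C1\<close>.\<close>
    then have "- \<Lambda> < l" using N_low[OF q(1), of l] l by linarith
    then have "N q1 l \<le> N q2 k"
      unfolding N_def k_def using L\<Omega> M q C0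
      by (intro add_right_mono pangle_le_after_shift[where M = M] w C1) auto
    moreover have "N q2 (- \<Lambda>) < real n * pi" using N_low[OF q(2) order.refl] np by linarith
    moreover have "- \<Lambda> \<le> k"
    proof (rule ccontr)
      assume "\<not> - \<Lambda> \<le> k"
      then show False using N_low[OF q(2), of k] \<open>N q1 l \<le> N q2 k\<close> l np by simp
    qed
    ultimately obtain k' where "- \<Lambda> \<le> k'" "k' \<le> k" "N q2 k' = real n * pi"
      using IVT'[of "N q2" "- \<Lambda>" "real n * pi" k] l continuous_on_subset[OF N_cont[OF q(2)]] by auto
    then show ?thesis unfolding k_def by blast
  qed
  have "\<bar>sl_eig \<alpha> \<beta> w q1 n - sl_eig \<alpha> \<beta> w q2 n\<bar> \<le> C * integral {0..1} (\<lambda>x. \<bar>q1 x - q2 x\<bar>)"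
    if n: "n \<ge> 1" and q: "q1 \<in> \<Omega>" "q2 \<in> \<Omega>" for n q1 q2
  proof (cases "\<exists>l. N q1 l = real n * pi")
    case True
    then obtain l where l: "N q1 l = real n * pi" by blast
    obtain k where k: "N q2 k = real n * pi" "k \<le> l + C * integral {0..1} (\<lambda>x. \<bar>q1 x - q2 x\<bar>)"
      using shift[OF q n l] by blast
    \<comment> \<open>Shifting back to \<open>q1\<close> reaches the level of \<open>l\<close>
      again, and strict monotonicity gives \<open>l' = l\<close>.\<close>
    obtain l' where l': "N q1 l' = real n * pi" "l' \<le> k + C * integral {0..1} (\<lambda>x. \<bar>q2 x - q1 x\<bar>)"
      using shift[OF q(2,1) n k(1)] by blast
    have "l' = l" using unique[OF q(1) l'(1) l] .
    moreover have "sl_eig \<alpha> \<beta> w q1 n = l"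
      unfolding eig[OF q(1) n] by (rule the_equality) (rule l, rule unique[OF q(1) _ l])
    moreover have "sl_eig \<alpha> \<beta> w q2 n = k"
      unfolding eig[OF q(2) n] by (rule the_equality) (rule k(1), rule unique[OF q(2) _ k(1)])
    ultimately show ?thesis using k(2) l'(2) by (simp add: abs_le_iff abs_minus_commute)
  next
    case False
    \<comment> \<open>This case never occurs, but ruling it out would need the growth of the angle as \<open>lam\<close> tends to infinity;
      both sides are then the same undefined value.\<close>
    then have "N q1 l \<noteq> real n * pi" "N q2 l \<noteq> real n * pi" for l using shift[OF q(2,1) n] by blast+
    then have "sl_eig \<alpha> \<beta> w q1 n = sl_eig \<alpha> \<beta> w q2 n"
      unfolding eig[OF q(1) n] eig[OF q(2) n] by simp
    moreover have "0 \<le> integral {0..1} (\<lambda>x. \<bar>q1 x - q2 x\<bar>)"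
      using L\<Omega> q by (intro integral_nonneg L1_int L1_abs L1_diff) auto
    ultimately show ?thesis using C0 by simp
  qed
  then show ?thesis using C0 by (intro that[of C]) (auto simp: \<Omega>_def)
qed

theorem theorem2p1:
  fixes \<alpha> \<beta> :: real and w :: "real \<Rightarrow> real"
  assumes "0 \<le> \<alpha>" "\<alpha> < pi" "0 \<le> \<beta>" "\<beta> < pi"
    and "w absolutely_integrable_on {0..1}"
    and "AE x in lebesgue_on {0..1}. w x > 0"
    and H1: "mono_on {0..1} w \<or> antimono_on {0..1} w"
    and H2: "(INF x\<in>{0..1}. w x) > 0"
  shows "\<forall>\<Omega>. (\<forall>q\<in>\<Omega>. q absolutely_integrable_on {0..1}) \<longrightarrow>
           (\<exists>M. \<forall>q\<in>\<Omega>. integral {0..1} (\<lambda>x. \<bar>q x\<bar>) \<le> M) \<longrightarrow>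
           (\<exists>C>0. \<forall>n\<ge>1. \<forall>q1\<in>\<Omega>. \<forall>q2\<in>\<Omega>.
              \<bar>sl_eig \<alpha> \<beta> w q1 n - sl_eig \<alpha> \<beta> w q2 n\<bar>
                \<le> C * integral {0..1} (\<lambda>x. \<bar>q1 x - q2 x\<bar>))"
proof (intro allI impI, elim exE)
  fix \<Omega> :: "(real \<Rightarrow> real) set" and M :: real
  assume "\<forall>q\<in>\<Omega>. q absolutely_integrable_on {0..1}" "\<forall>q\<in>\<Omega>. integral {0..1} (\<lambda>x. \<bar>q x\<bar>) \<le> M"
  moreover obtain C where "C > 0" "\<And>n q1 q2. n \<ge> 1 \<Longrightarrow> L1 q1 \<Longrightarrow> L1 q2 \<Longrightarrow>
      integral {0..1} (\<lambda>x. \<bar>q1 x\<bar>) \<le> M \<Longrightarrow> integral {0..1} (\<lambda>x. \<bar>q2 x\<bar>) \<le> M \<Longrightarrow>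
      \<bar>sl_eig \<alpha> \<beta> w q1 n - sl_eig \<alpha> \<beta> w q2 n\<bar> \<le> C * integral {0..1} (\<lambda>x. \<bar>q1 x - q2 x\<bar>)"
    by (rule sl_eig_lipschitz[OF assms(1-5,7,8), of M]) (rule that)
  ultimately show "\<exists>C>0. \<forall>n\<ge>1. \<forall>q1\<in>\<Omega>. \<forall>q2\<in>\<Omega>.
      \<bar>sl_eig \<alpha> \<beta> w q1 n - sl_eig \<alpha> \<beta> w q2 n\<bar> \<le> C * integral {0..1} (\<lambda>x. \<bar>q1 x - q2 x\<bar>)"
    by (intro exI[of _ C]) simp
qed

end
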